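(* Let $\mathbf Z=(\mathbf Y,\mathbf X)$ be an ergodic unreliable Jackson network process with stationary distribution $\tilde\pi$ whose rerouting matrices $(R^D)_{D\subseteq\tilde J}$ satisfy the rerouting assumption. Assume that for all $D\subseteq\tilde J$ with $\hat\pi(D)>0$ the routing matrix $R^D=[r^D_{ij}]_{i,j\in\tilde J_0\setminus D}$ has strictly positive entrance and departure probabilities ($r^D_{0i}>0$, $r^D_{i0}>0$) for every node $i\in\tilde J\setminus D$. Assume further that for all $D\subseteq\tilde J$ the rerouting $R^D$ fulfills overall balance for all network nodes which are up, i.e. $$\eta_j\sum_{i\in\tilde J\setminus D}r^D_{ji}=\sum_{i\in\tilde J\setminus D}\eta_ir^D_{ij},\qquad\forall j\in\tilde J\setminus D.$$ Then there exists an ergodic unreliable Jackson network process $\mathbf Z'$, satisfying the rerouting assumption and with the same stationary distribution $\tilde\pi$ as $\mathbf Z$, such that $$\mathrm{Gap}(Q^{\mathbf Z'})\le\mathrm{Gap}(Q^{\mathbf Z}),$$ and such that the nodes of $\mathbf Z'$ are perturbed by a common breakdown-repair regime identical to that of $\mathbf Z$, and for any given set $D$ of broken down nodes the joint network process of $\mathbf Z'$ on $\tilde J\setminus D$ consists of conditionally independent birth-death processes, the process on the $i$-th coordinate ($i\in\tilde J\setminus D$) having birth rate $\lambda r^D_{0i}$ and state dependent death rate $\mu_i(n_i)r^D_{i0}$.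
   Context: Notation: $\mathbb N=\{0,1,2,\dots\}$, $\tilde J=\{1,\dots,J\}$, $\tilde J_0=\{0,1,\dots,J\}$; $\subset$ denotes strict inclusion; $e_j$ is the $j$-th standard base vector of $\mathbb N^J$. $\langle f,g\rangle_{\nu}=\int fg\,d\nu$. Network data: an arrival intensity $\lambda>0$; an irreducible stochastic routing matrix $R=[r_{ij}]_{i,j\in\tilde J_0}$ ($r_{00}\ge 0$ allowed; node $0$ is source and sink); service rates $\mu_j(k)>0$ for $k\ge1$, $\mu_j(0)=0$, with $\sup_{j,k}\mu_j(k)<\infty$. The traffic equations $\eta_j=\lambda r_{0j}+\sum_{i=1}^J\eta_ir_{ij}$, $j\in\tilde J$, have a unique solution $(\eta_j)_{j\in\tilde J}$. The network (without breakdowns) is assumed ergodic, i.e. $C_j:=\sum_{m\ge0}\prod_{k=1}^{m}\eta_j/\mu_j(k)<\infty$ for all $j$, and $\pi(n)=\prod_{j=1}^J C_j^{-1}\prod_{k=1}^{n_j}\frac{\eta_j}{\mu_j(k)}$ on $\mathbb N^J$. Breakdown and repair: functions $A,B:2^{\tilde J}\to[0,\infty)$ with $A(\emptyset)=B(\emptyset)=1$, $A(I)/A(D)<\infty$ for all $D\subset I\subseteq\tilde J$ and $B(D)/B(H)<\infty$ for all $H\subset D\subseteq\tilde J$ (conventions $0/0=0$, $1/0=\infty$). $\mathbf Y$ is the Markov process on $2^{\tilde J}$ (its state is the set of broken down nodes) with rates $q^{\mathbf Y}(D,I)=A(I)/A(D)$ for $D\subset I$, $q^{\mathbf Y}(D,H)=B(D)/B(H)$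 for $H\subset D$, other off-diagonal rates zero, and generator $(Q^{\mathbf Y}h)(D)=\sum_{H\subset D}q^{\mathbf Y}(D,H)(h(H)-h(D))+\sum_{I\supset D}q^{\mathbf Y}(D,I)(h(I)-h(D))$. It is reversible with respect to the probability $\hat\pi(D)=\hat C^{-1}A(D)/B(D)$. Rerouting assumption: for each $D\subseteq\tilde J$ there is a stochastic matrix $R^D=[r^D_{ij}]_{i,j\in\tilde J_0\setminus D}$, $R^\emptyset=R$, such that $\eta_j=\lambda r^D_{0j}+\sum_{i\in\tilde J\setminus D}\eta_ir^D_{ij}$ for all $j\in\tilde J\setminus D$ (same $\eta$ for every $D$; $\eta^D_j:=\eta_j$). Unreliable Jackson network process $\mathbf Z=(\mathbf Y,\mathbf X)$: the Markov process on $\tilde{\mathbb E}=2^{\tilde J}\times\mathbb N^J$ with generator $(Q^{\mathbf Z}f)(D,n)=\sum_{j\in\tilde J\setminus D}\lambda r^D_{0j}(f(D,n+e_j)-f(D,n))+\sum_{j\in\tilde J\setminus D}\mu_j(n_j)r^D_{j0}(f(D,n-e_j)-f(D,n))+\sum_{j\in\tilde J\setminus D}\mu_j(n_j)\sum_{i\in\tilde J\setminus D}r^D_{ji}(f(D,n-e_j+e_i)-f(D,n))+(Q^{\mathbf Y}f(\cdot,n))(D)$. Terms with factor $\mu_j(0)$ are zero. If $\mathbf Z$ is ergodic, its unique stationary distribution is known to be $\tilde\pi(D,n)=\hat\pi(D)\pi(n)$. The description of $\mathbf Z'$ means: its transitions out of $(D,n)$ to a different state are exactly $(D,n)\to(D,n+e_i)$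 at rate $\lambda r^D_{0i}$ and $(D,n)\to(D,n-e_i)$ at rate $\mu_i(n_i)r^D_{i0}$ for $i\in\tilde J\setminus D$, and $(D,n)\to(H,n)$ at rate $q^{\mathbf Y}(D,H)$ for $H\ne D$. Spectral gap: $\mathrm{Gap}(Q^{\mathbf Z})=\inf\{\langle f,-Q^{\mathbf Z}f\rangle_{\tilde\pi}: f\in L^2(\tilde{\mathbb E},\tilde\pi),\ \tilde\pi(f)=0,\ \langle f,f\rangle_{\tilde\pi}=1\}$, where $\tilde\pi(f)=\int f\,d\tilde\pi$. *)

theory Defs
  imports "HOL-Analysis.Analysis"
begin

section \<open>Bounded generators on a discrete state space\<close>

text \<open>
  A generator is given as an operator on real functions on the state space. All generators below
  have bounded rates, so that the transition semigroup is the exponential series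
  \<open>P\<^sub>t = exp (t Q)\<close> (absolutely convergent on bounded functions).
\<close>

type_synonym 's generator = "('s \<Rightarrow> real) \<Rightarrow> 's \<Rightarrow> real"

definition rate :: "'s generator \<Rightarrow> 's \<Rightarrow> 's \<Rightarrow> real" where
  "rate Q x y = Q (indicat_real {y}) x"

definition exp_semigroup :: "'s generator \<Rightarrow> real \<Rightarrow> 's generator" where
  "exp_semigroup Q t f x = (\<Sum>k. t ^ k / fact k * (Q ^^ k) f x)"

definition trans_prob :: "'s generator \<Rightarrow> real \<Rightarrow> 's \<Rightarrow> 's \<Rightarrow> real" where
  "trans_prob Q t x y = exp_semigroup Q t (indicat_real {y}) x"

definition stationary_distribution :: "'s generator \<Rightarrow> ('s \<Rightarrow> real) \<Rightarrow> bool" where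
  "stationary_distribution Q p \<longleftrightarrow>
     (\<forall>x. 0 \<le> p x) \<and> (p has_sum 1) UNIV \<and>
     (\<forall>t\<ge>0. \<forall>y. ((\<lambda>x. p x * trans_prob Q t x y) has_sum p y) UNIV)"

text \<open>
  Ergodicity: from every initial state the law at time \<open>t\<close> converges to one and the same
  stationary distribution (which is therefore the only one). Irreducibility on the whole state
  space is not required: states of stationary probability zero may be transient.
\<close>

definition ergodic :: "'s generator \<Rightarrow> bool" where
  "ergodic Q \<longleftrightarrow>
     (\<exists>p. stationary_distribution Q p \<and>
          (\<forall>x y. ((\<lambda>t. trans_prob Q t x y) \<longlongrightarrow> p y) at_top))"

definition dist_measure :: "('s \<Rightarrow> real) \<Rightarrow> 's measure" where
  "dist_measure p = point_measure UNIV (\<lambda>x. ennreal (p x))"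

definition L2 :: "('s \<Rightarrow> real) \<Rightarrow> ('s \<Rightarrow> real) set" where
  "L2 p = {f. integrable (dist_measure p) (\<lambda>x. (f x)\<^sup>2)}"

definition inner_prod :: "('s \<Rightarrow> real) \<Rightarrow> ('s \<Rightarrow> real) \<Rightarrow> ('s \<Rightarrow> real) \<Rightarrow> real" where
  "inner_prod p f g = (\<integral>x. f x * g x \<partial>dist_measure p)"

definition Gap :: "'s generator \<Rightarrow> ('s \<Rightarrow> real) \<Rightarrow> real" where
  "Gap Q p = Inf {inner_prod p f (\<lambda>x. - Q f x) | f.
     f \<in> L2 p \<and> (\<integral>x. f x \<partial>dist_measure p) = 0 \<and> inner_prod p f f = 1}"


section \<open>Unreliable Jackson networks\<close>

text \<open>
  The nodes \<open>1, \<dots>, J\<close> are the elements of a finite type \<open>'j\<close>, so \<open>'j set\<close> is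
  the set of breakdown states and \<open>'j \<Rightarrow> nat\<close> the set of queue length vectors. The index set
  \<open>0, 1, \<dots>, J\<close> is \<open>'j option\<close>, where \<open>None\<close> is the source and sink \<open>0\<close>.
  \<open>route N D\<close> is the routing matrix used while the nodes in \<open>D\<close> are down (only its entries
  indexed by \<open>up_nodes0 D\<close> matter), and \<open>route N {}\<close> is the routing matrix of the network
  without breakdowns. \<open>brk\<close> and \<open>rep\<close> are the functions \<open>A\<close> and \<open>B\<close>
  governing breakdown and repair, \<open>arr\<close> is the arrival intensity \<open>\<lambda>\<close>. The traffic solution \<open>eta\<close>, which is determined by the other
  data, is carried along as a component constrained by the traffic equations.
\<close>

record 'j network =
  arr :: real
  route :: "'j set \<Rightarrow> 'j option \<Rightarrow> 'j option \<Rightarrow> real"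
  mu :: "'j \<Rightarrow> nat \<Rightarrow> real"
  eta :: "'j \<Rightarrow> real"
  brk :: "'j set \<Rightarrow> real"
  rep :: "'j set \<Rightarrow> real"

type_synonym 'j state = "'j set \<times> ('j \<Rightarrow> nat)"

definition up_nodes0 :: "'j set \<Rightarrow> 'j option set" where
  "up_nodes0 D = insert None (Some ` (- D))"

definition stochastic_on :: "'a set \<Rightarrow> ('a \<Rightarrow> 'a \<Rightarrow> real) \<Rightarrow> bool" where
  "stochastic_on I r \<longleftrightarrow> (\<forall>i\<in>I. (\<forall>j\<in>I. 0 \<le> r i j) \<and> (\<Sum>j\<in>I. r i j) = 1)"

definition irreducible_on :: "'a set \<Rightarrow> ('a \<Rightarrow> 'a \<Rightarrow> real) \<Rightarrow> bool" where
  "irreducible_on I r \<longleftrightarrow>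
     (\<forall>i\<in>I. \<forall>j\<in>I. (i, j) \<in> {(a, b). a \<in> I \<and> b \<in> I \<and> 0 < r a b}\<^sup>*)"

definition traffic :: "'j::finite network \<Rightarrow> 'j set \<Rightarrow> bool" where
  "traffic N D \<longleftrightarrow>
     (\<forall>j\<in>- D. eta N j = arr N * route N D None (Some j)
                       + (\<Sum>i\<in>- D. eta N i * route N D (Some i) (Some j)))"

definition service_weight :: "'j network \<Rightarrow> 'j \<Rightarrow> nat \<Rightarrow> real" where
  "service_weight N j m = (\<Prod>k=1..m. eta N j / mu N j k)"

definition jackson_network :: "'j::finite network \<Rightarrow> bool" where
  "jackson_network N \<longleftrightarrow>
     0 < arr N \<and>
     stochastic_on UNIV (route N {}) \<and> irreducible_on UNIV (route N {}) \<and>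
     (\<forall>j. mu N j 0 = 0 \<and> (\<forall>k\<ge>1. 0 < mu N j k)) \<and>
     bdd_above (range (\<lambda>(j, k). mu N j k)) \<and>
     traffic N {} \<and>
     (\<forall>j. summable (service_weight N j))"

text \<open>
  With the convention \<open>0/0 = 0\<close>, \<open>1/0 = \<infinity>\<close>, finiteness of a quotient \<open>a/b\<close> of
  nonnegative numbers means that \<open>b = 0\<close> implies \<open>a = 0\<close>.
\<close>

definition breakdown_repair :: "'j::finite network \<Rightarrow> bool" where
  "breakdown_repair N \<longleftrightarrow>
     (\<forall>D. 0 \<le> brk N D \<and> 0 \<le> rep N D) \<and> brk N {} = 1 \<and> rep N {} = 1 \<and>
     (\<forall>D I. D \<subset> I \<longrightarrow> brk N D = 0 \<longrightarrow> brk N I = 0) \<and>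
     (\<forall>H D. H \<subset> D \<longrightarrow> rep N H = 0 \<longrightarrow> rep N D = 0)"

definition rerouting :: "'j::finite network \<Rightarrow> bool" where
  "rerouting N \<longleftrightarrow> (\<forall>D. stochastic_on (up_nodes0 D) (route N D) \<and> traffic N D)"

definition norm_const :: "'j network \<Rightarrow> 'j \<Rightarrow> real" where
  "norm_const N j = (\<Sum>m. service_weight N j m)"

definition pi_queue :: "'j::finite network \<Rightarrow> ('j \<Rightarrow> nat) \<Rightarrow> real" where
  "pi_queue N n = (\<Prod>j\<in>UNIV. inverse (norm_const N j) * service_weight N j (n j))"

text \<open>
  Here \<open>1/0\<close> evaluates to \<open>0\<close> rather than \<open>\<infinity>\<close>. The values \<open>rep N D = 0\<close>
  are incompatible with ergodicity of the network process: then also \<open>rep N UNIV = 0\<close>, and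
  all states \<open>(UNIV, n)\<close> are absorbing.
\<close>

definition pi_hat :: "'j::finite network \<Rightarrow> 'j set \<Rightarrow> real" where
  "pi_hat N D = inverse (\<Sum>E\<in>UNIV. brk N E / rep N E) * (brk N D / rep N D)"

definition pi_tilde :: "'j::finite network \<Rightarrow> 'j state \<Rightarrow> real" where
  "pi_tilde N = (\<lambda>(D, n). pi_hat N D * pi_queue N n)"

definition qY :: "'j network \<Rightarrow> 'j set \<Rightarrow> 'j set \<Rightarrow> real" where
  "qY N D E = (if D \<subset> E then brk N E / brk N D
               else if E \<subset> D then rep N D / rep N E
               else 0)"

definition QY :: "'j::finite network \<Rightarrow> 'j set generator" where
  "QY N h D = (\<Sum>H | H \<subset> D. qY N D H * (h H - h D)) + (\<Sum>I | D \<subset> I. qY N D I * (h I - h D))"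

definition inc :: "'j \<Rightarrow> ('j \<Rightarrow> nat) \<Rightarrow> 'j \<Rightarrow> nat" where
  "inc i n = n(i := n i + 1)"

definition dec :: "'j \<Rightarrow> ('j \<Rightarrow> nat) \<Rightarrow> 'j \<Rightarrow> nat" where
  "dec i n = n(i := n i - 1)"

text \<open>
  The value of the truncated \<open>dec j n\<close> at \<open>n j = 0\<close> is irrelevant: the corresponding terms
  carry the factor \<open>mu N j 0 = 0\<close>.
\<close>

definition QZ :: "'j::finite network \<Rightarrow> 'j state generator" where
  "QZ N f = (\<lambda>(D, n).
      (\<Sum>j\<in>- D. arr N * route N D None (Some j) * (f (D, inc j n) - f (D, n)))
    + (\<Sum>j\<in>- D. mu N j (n j) * route N D (Some j) None * (f (D, dec j n) - f (D, n)))
    + (\<Sum>j\<in>- D. mu N j (n j) *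
        (\<Sum>i\<in>- D. route N D (Some j) (Some i) * (f (D, inc i (dec j n)) - f (D, n))))
    + QY N (\<lambda>E. f (E, n)) D)"

definition overall_balance :: "'j::finite network \<Rightarrow> 'j set \<Rightarrow> bool" where
  "overall_balance N D \<longleftrightarrow>
     (\<forall>j\<in>- D. eta N j * (\<Sum>i\<in>- D. route N D (Some j) (Some i))
            = (\<Sum>i\<in>- D. eta N i * route N D (Some i) (Some j)))"

text \<open>
  The transitions of \<open>Q\<close> out of \<open>(D, n)\<close> to other states: given \<open>D\<close>, each coordinate
  \<open>i\<close> outside \<open>D\<close> performs a birth-death move with the birth and death rates taken from
  \<open>N\<close>, coordinates never move jointly, and \<open>D\<close> changes according to the breakdown-repair
  rates of \<open>N\<close>.
\<close>

definition cond_indep_birth_death :: "'j::finite network \<Rightarrow> 'j state generator \<Rightarrow> bool" where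
  "cond_indep_birth_death N Q \<longleftrightarrow> (\<forall>D n.
     (\<forall>i\<in>- D. rate Q (D, n) (D, inc i n) = arr N * route N D None (Some i)) \<and>
     (\<forall>i\<in>- D. 0 < n i \<longrightarrow>
        rate Q (D, n) (D, dec i n) = mu N i (n i) * route N D (Some i) None) \<and>
     (\<forall>H. H \<noteq> D \<longrightarrow> rate Q (D, n) (H, n) = qY N D H) \<and>
     (\<forall>y. y \<noteq> (D, n) \<longrightarrow>
        (\<forall>i\<in>- D. y \<noteq> (D, inc i n) \<and> y \<noteq> (D, dec i n)) \<longrightarrow>
        (\<forall>H. y \<noteq> (H, n)) \<longrightarrow> rate Q (D, n) y = 0))"

end

theory Submission
  imports Defs
begin

text \<open>
  The network \<open>N'\<close> is obtained from \<open>N\<close> by cancelling all transfers between nodes: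
  a customer who would be sent from \<open>j\<close> to any node that is up is instead fed back to \<open>j\<close>.
  The probabilities of entering and of leaving the network are kept. Overall balance turns the
  traffic equations into the local identities \<open>\<lambda> r\<^sub>0\<^sub>j = \<eta>\<^sub>j r\<^sub>j\<^sub>0\<close>, so \<open>\<eta>\<close> still
  solves the traffic equations of \<open>N'\<close>, and the arrivals, departures and breakdown-repair
  transitions that remain are reversible with respect to \<open>pi_tilde N\<close>.

  The generator of \<open>N\<close> is the sum of the generator of \<open>N'\<close> and of a generator \<open>T\<close> that
  consists of the transfers alone. The key identity \<open>shift_identity\<close>, which says that summing
  over states weighted by the service rate of a node is, up to the factor \<open>\<eta>\<close> of that
  node, summing over states with one customer more there, together with overall balance shows that \<open>pi_tilde N\<close> is invariant for \<open>T\<close>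
  as well. A generator with an invariant distribution has a nonnegative Dirichlet form, reversible
  or not (\<open>dirichlet_form_nonneg\<close>). Hence the Dirichlet form of \<open>N\<close> dominates
  the one of \<open>N'\<close> function by function, and so do the infima.

  Ergodicity of \<open>N'\<close> is proved by uniformisation: the semigroup of a generator with bounded
  rates is a Poisson average of the powers of a Markov operator \<open>P\<close> with positive holding
  probabilities. The energies \<open>\<integral> (P\<^sup>k f)\<^sup>2\<close> decrease, and their decrements are
  integrals of the conditional variances of \<open>P\<^sup>k f\<close> over one step. These variances therefore tend to
  \<open>0\<close> on the support of the invariant distribution, which forces the values of \<open>P\<^sup>k f\<close> at
  neighbouring states to merge. In a connected support, \<open>P\<^sup>k f\<close> then tends to its mean by
  dominated convergence. The states of probability \<open>0\<close> are those whose set \<open>D\<close> of broken nodes has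
  \<open>A(D) = 0\<close>; each of them is left for the support at a rate bounded away from \<open>0\<close>,
  because one repair brings all nodes up again. This, like the reversibility of the breakdown-repair
  regime, requires that \<open>B\<close> vanishes nowhere, which is forced by the ergodicity of \<open>N\<close>.
\<close>

section \<open>Sums over discrete spaces and Poisson averages\<close>

lemma nn_integral_count_space_has_sum:
  fixes f :: "'a \<Rightarrow> real"
  assumes "\<And>x. 0 \<le> f x" and "(f has_sum s) UNIV"
  shows "(\<integral>\<^sup>+x. ennreal (f x) \<partial>count_space UNIV) = ennreal s"
proof -
  have "f summable_on UNIV" using assms(2) by (rule has_sum_imp_summable)
  hence "(\<lambda>x. norm (f x)) summable_on UNIV" using assms(1) by simp
  hence abs: "Infinite_Set_Sum.abs_summable_on f UNIV" by (subst abs_summable_equivalent[symmetric])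
  hence "infsetsum f UNIV = s"
    using infsetsum_infsum[OF abs] infsumI[OF assms(2)] by simp
  with nn_integral_conv_infsetsum[OF abs] assms(1) show ?thesis by simp
qed

lemma has_sum_nn_integral_count_space:
  fixes f :: "'a \<Rightarrow> real"
  assumes "\<And>x. 0 \<le> f x" and "0 \<le> s"
    and "(\<integral>\<^sup>+x. ennreal (f x) \<partial>count_space UNIV) = ennreal s"
  shows "(f has_sum s) UNIV"
proof -
  have "integrable (count_space UNIV) f"
    by (rule integrableI_nn_integral_finite[OF _ _ assms(3)]) (use assms in auto)
  hence abs: "Infinite_Set_Sum.abs_summable_on f UNIV" by (simp add: Infinite_Set_Sum.abs_summable_on_def)
  hence "f summable_on UNIV" using abs_summable_equivalent abs_summable_summable by blast
  moreover have "infsum f UNIV = s"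
    using infsetsum_infsum[OF abs] infsetsum_conv_nn_integral[of UNIV f] assms by simp
  ultimately show ?thesis by (simp add: has_sum_iff)
qed

lemma measurable_dist_measure [measurable, simp]:
  "f \<in> borel_measurable (dist_measure p)" for f :: "'s \<Rightarrow> 'b::topological_space"
  by (simp add: dist_measure_def)

lemma nn_integral_dist_measure:
  "(\<integral>\<^sup>+x. h x \<partial>dist_measure p) = (\<integral>\<^sup>+x. ennreal (p x) * h x \<partial>count_space UNIV)"
  by (simp add: dist_measure_def point_measure_def nn_integral_density)

lemma poisson_sums: "(\<lambda>k. exp (- t) * t ^ k / fact k) sums (1::real)"
proof -
  have "(\<lambda>k. t ^ k / fact k) sums exp t"
    using exp_converges[of t] by (simp add: field_simps)
  from sums_mult[OF this, of "exp (- t)"] show ?thesis by (simp add: exp_minus)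
qed

lemma poisson_average_summable:
  fixes s :: "nat \<Rightarrow> real"
  assumes "\<And>k. \<bar>s k\<bar> \<le> B" and "0 \<le> t"
  shows "summable (\<lambda>k. exp (- t) * t ^ k / fact k * s k)"
proof (rule summable_comparison_test')
  show "summable (\<lambda>k. exp (- t) * t ^ k / fact k * B)"
    by (intro summable_mult2 sums_summable[OF poisson_sums])
  fix k :: nat
  show "norm (exp (- t) * t ^ k / fact k * s k) \<le> exp (- t) * t ^ k / fact k * B"
    using assms by (simp add: abs_mult divide_right_mono mult_left_mono)
qed

text \<open>
  As its parameter grows, the Poisson distribution loses all its mass on every fixed initial
  segment, so its averages see only the tail of the sequence.
\<close>
lemma poisson_average_tendsto:
  fixes s :: "nat \<Rightarrow> real"
  assumes bound: "\<And>k. \<bar>s k\<bar> \<le> B" and lim: "s \<longlonglongrightarrow> L"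
  shows "((\<lambda>t. \<Sum>k. exp (- t) * t ^ k / fact k * s k) \<longlongrightarrow> L) at_top"
proof (rule tendstoI)
  fix e :: real assume "e > 0"
  then obtain n where n: "\<And>k. n \<le> k \<Longrightarrow> \<bar>s k - L\<bar> < e / 2"
    using lim by (metis LIMSEQ_D half_gt_zero real_norm_def)
  let ?p = "\<lambda>t k. exp (- t) * t ^ k / fact k :: real"
  let ?R = "\<lambda>t. \<Sum>k<n. ?p t k * \<bar>s k - L\<bar>"
  have "((\<lambda>t. t ^ k / exp t * (\<bar>s k - L\<bar> / fact k)) \<longlongrightarrow> 0) at_top" for k
    by (rule tendsto_mult_left_zero[OF tendsto_power_div_exp_0])
  hence "((\<lambda>t. ?p t k * \<bar>s k - L\<bar>) \<longlongrightarrow> 0) at_top" for k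
    by (simp add: exp_minus field_simps)
  hence "(?R \<longlongrightarrow> 0) at_top" by (intro tendsto_null_sum)
  hence "eventually (\<lambda>t. ?R t < e / 2) at_top"
    by (rule order_tendstoD) (use \<open>e > 0\<close> in simp)
  thus "eventually (\<lambda>t. dist (\<Sum>k. ?p t k * s k) L < e) at_top"
    using eventually_ge_at_top[of 0]
  proof eventually_elim
    case (elim t)
    have d: "\<bar>s k - L\<bar> \<le> B + \<bar>L\<bar>" for k using bound[of k] by linarith
    have sd: "summable (\<lambda>k. ?p t k * (s k - L))" "summable (\<lambda>k. ?p t k * \<bar>s k - L\<bar>)"
      by (intro poisson_average_summable[where B = "B + \<bar>L\<bar>"]; use d elim in simp)+
    have "(\<Sum>k. ?p t k * (s k - L)) = (\<Sum>k. ?p t k * s k) - (\<Sum>k. ?p t k * L)"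
      unfolding right_diff_distrib
      by (intro suminf_diff[symmetric] poisson_average_summable[where B = B] summable_mult2
          sums_summable[OF poisson_sums] bound elim)
    also have "(\<Sum>k. ?p t k * L) = L"
      using sums_unique[OF sums_mult2[OF poisson_sums, of t L]] by simp
    finally have "\<bar>(\<Sum>k. ?p t k * s k) - L\<bar> = \<bar>\<Sum>k. ?p t k * (s k - L)\<bar>" by simp
    also have "\<dots> \<le> (\<Sum>k. \<bar>?p t k * (s k - L)\<bar>)"
      by (rule summable_rabs) (use sd(2) elim in \<open>simp add: abs_mult\<close>)
    also have "\<dots> = (\<Sum>k. ?p t k * \<bar>s k - L\<bar>)" using elim by (simp add: abs_mult)
    also have "\<dots> = (\<Sum>k. ?p t (k + n) * \<bar>s (k + n) - L\<bar>) + ?R t"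
      by (rule suminf_split_initial_segment[OF sd(2)])
    also have "(\<Sum>k. ?p t (k + n) * \<bar>s (k + n) - L\<bar>) \<le> (\<Sum>k. ?p t (k + n) * (e / 2))"
    proof (rule suminf_le)
      show "summable (\<lambda>k. ?p t (k + n) * \<bar>s (k + n) - L\<bar>)"
        using sd(2) by (rule summable_ignore_initial_segment)
      show "summable (\<lambda>k. ?p t (k + n) * (e / 2))"
        by (intro summable_mult2) (rule summable_ignore_initial_segment[OF sums_summable[OF poisson_sums]])
      show "?p t (k + n) * \<bar>s (k + n) - L\<bar> \<le> ?p t (k + n) * (e / 2)" for k
        using n[of "k + n"] elim by (intro mult_left_mono) auto
    qed
    also have "\<dots> = (\<Sum>k. ?p t (k + n)) * (e / 2)"
      by (rule suminf_mult2[symmetric])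
        (rule summable_ignore_initial_segment[OF sums_summable[OF poisson_sums]])
    also have "\<dots> \<le> 1 * (e / 2)"
    proof (rule mult_right_mono)
      have "1 = (\<Sum>k. ?p t (k + n)) + (\<Sum>k<n. ?p t k)"
        using suminf_split_initial_segment[OF sums_summable[OF poisson_sums], of t n]
          sums_unique[OF poisson_sums, of t] by simp
      moreover have "0 \<le> (\<Sum>k<n. ?p t k)" using elim by (intro sum_nonneg) simp
      ultimately show "(\<Sum>k. ?p t (k + n)) \<le> 1" by linarith
    qed (use \<open>e > 0\<close> in simp)
    finally show ?case using elim by (simp add: dist_real_def)
  qed
qed

text \<open>
  The inductive step for the binomial expansion of \<open>(c + G)\<^sup>n\<close>, read off one coordinate of an
  orbit \<open>a i = G\<^sup>i f x\<close>.
\<close>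
lemma binomial_expansion_step:
  fixes a :: "nat \<Rightarrow> real"
  shows "(\<Sum>i\<le>Suc n. real (Suc n choose i) * c ^ (Suc n - i) * a i) =
    (\<Sum>i\<le>n. real (n choose i) * c ^ (n - i) * (c * a i + a (Suc i)))"
proof -
  have "(\<Sum>i\<le>Suc n. real (Suc n choose i) * c ^ (Suc n - i) * a i) =
     c ^ Suc n * a 0 + (\<Sum>i\<le>n. real (Suc n choose Suc i) * c ^ (n - i) * a (Suc i))"
    by (subst sum.atMost_Suc_shift) simp
  also have "(\<Sum>i\<le>n. real (Suc n choose Suc i) * c ^ (n - i) * a (Suc i)) =
     (\<Sum>i\<le>n. real (n choose i) * c ^ (n - i) * a (Suc i)) +
     (\<Sum>i\<le>n. real (n choose Suc i) * c ^ (n - i) * a (Suc i))"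
    by (simp add: algebra_simps sum.distrib)
  finally have "(\<Sum>i\<le>Suc n. real (Suc n choose i) * c ^ (Suc n - i) * a i) =
     c ^ Suc n * a 0 + ((\<Sum>i\<le>n. real (n choose i) * c ^ (n - i) * a (Suc i)) +
     (\<Sum>i\<le>n. real (n choose Suc i) * c ^ (n - i) * a (Suc i)))" .
  moreover have "(\<Sum>i\<le>n. real (n choose Suc i) * c ^ (n - i) * a (Suc i)) + c ^ Suc n * a 0 =
     (\<Sum>i\<le>Suc n. real (n choose i) * c ^ (Suc n - i) * a i)"
    by (subst sum.atMost_Suc_shift) simp
  moreover have "\<dots> = (\<Sum>i\<le>n. real (n choose i) * c ^ (n - i) * (c * a i))"
    by (auto simp: Suc_diff_le mult_ac intro!: sum.cong)
  ultimately show ?thesis by (simp only: distrib_left sum.distrib)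
qed

text \<open>
  Two absorbing states would both have to carry the whole mass of the limit distribution.
\<close>
lemma absorbing_not_ergodic:
  assumes absorbing: "\<And>f. Q f x = 0" "\<And>f. Q f y = 0" and "x \<noteq> y"
  shows "\<not> ergodic Q"
proof
  assume "ergodic Q"
  then obtain p where p: "\<And>x y. ((\<lambda>t. trans_prob Q t x y) \<longlongrightarrow> p y) at_top"
    by (auto simp: ergodic_def)
  have const: "trans_prob Q t z u = indicat_real {u} z" if "\<And>f. Q f z = 0" for t u z
  proof -
    have "(Q ^^ k) (indicat_real {u}) z = (if k = 0 then indicat_real {u} z else 0)" for k
      using that by (cases k) auto
    hence "trans_prob Q t z u = (\<Sum>k. if k = 0 then t ^ k / fact k * indicat_real {u} z else 0)"
      unfolding trans_prob_def exp_semigroup_def by (intro arg_cong[where f = suminf]) auto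
    also have "\<dots> = indicat_real {u} z"
      using suminf_finite[of "{0}" "\<lambda>k. if k = 0 then t ^ k / fact k * indicat_real {u} z else 0"] by simp
    finally show ?thesis .
  qed
  have "p y = indicat_real {y} z" if "\<And>f. Q f z = 0" for z
    using p[of z y] unfolding const[OF that] by (intro tendsto_unique[OF _ _ tendsto_const]) auto
  from this[OF absorbing(1)] this[OF absorbing(2)] \<open>x \<noteq> y\<close> show False by simp
qed

lemma funpow_linear:
  fixes T :: "('a \<Rightarrow> real) \<Rightarrow> 'a \<Rightarrow> real"
  assumes "\<And>a f g. T (\<lambda>x. a * f x + g x) = (\<lambda>x. a * T f x + T g x)"
  shows "(T ^^ k) (\<lambda>x. a * f x + g x) = (\<lambda>x. a * (T ^^ k) f x + (T ^^ k) g x)"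
  by (induction k) (simp_all add: assms)

section \<open>Jump generators with finitely many kinds of moves\<close>

text \<open>
  From state \<open>x\<close>, move \<open>m\<close> leads to \<open>move m x\<close> at rate \<open>w m x\<close>. The last assumption is
  invariance of \<open>p\<close> in integrated form: the mean flow into and out of every state agree. Stating
  it with nonnegative extended functions makes it available before anything is known about
  integrability.
\<close>
locale jump_generator =
  fixes w :: "'m::finite \<Rightarrow> 's \<Rightarrow> real" and move :: "'m \<Rightarrow> 's \<Rightarrow> 's"
    and p :: "'s \<Rightarrow> real"
  assumes w_nonneg: "0 \<le> w m x" and w_bounded: "\<exists>K. \<forall>m x. w m x \<le> K"
    and p_nonneg: "0 \<le> p x" and p_sum: "(p has_sum 1) UNIV"
    and balance: "\<And>h :: 's \<Rightarrow> ennreal.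
      (\<integral>\<^sup>+x. (\<Sum>m\<in>UNIV. ennreal (w m x) * h (move m x)) \<partial>dist_measure p) =
      (\<integral>\<^sup>+x. (\<Sum>m\<in>UNIV. ennreal (w m x) * h x) \<partial>dist_measure p)"
begin

abbreviation M :: "'s measure" where "M \<equiv> dist_measure p"

definition gen :: "'s generator" where
  "gen f x = (\<Sum>m\<in>UNIV. w m x * (f (move m x) - f x))"

definition K :: real where "K = (SOME K. \<forall>m x. w m x \<le> K)"

text \<open>
  The jump rate of the uniformised chain. Being strictly above every total rate, it leaves a
  positive probability of staying at each state.
\<close>
definition clock :: real where "clock = real CARD('m) * K + 1"

definition stay :: "'s \<Rightarrow> real" where "stay x = 1 - (\<Sum>m\<in>UNIV. w m x / clock)"

text \<open>
  The transition operator \<open>P\<close> of the uniformised chain.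
\<close>
definition step :: "'s generator" where
  "step f x = (\<Sum>m\<in>UNIV. w m x / clock * f (move m x)) + stay x * f x"

lemma AE_M: "(AE x in M. P x) \<longleftrightarrow> (\<forall>x. 0 < p x \<longrightarrow> P x)"
  unfolding dist_measure_def point_measure_def by (subst AE_density) (simp_all add: AE_count_space)

lemma emeasure_M: "emeasure M (space M) = 1"
  using nn_integral_dist_measure[of p "\<lambda>_. 1"] nn_integral_count_space_has_sum[OF p_nonneg p_sum]
  by simp

lemma finite_measure_M: "finite_measure M"
  by (rule finite_measureI) (simp add: emeasure_M)

lemma integrable_bounded: "(\<And>x. \<bar>f x\<bar> \<le> B) \<Longrightarrow> integrable M f" for f :: "'s \<Rightarrow> real"
  by (rule finite_measure.integrable_const_bound[OF finite_measure_M, of _ B]) auto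

lemma measure_M: "measure M (space M) = 1"
  by (simp add: measure_def emeasure_M)

lemma w_le: "w m x \<le> K"
  using someI_ex[OF w_bounded] by (simp add: K_def)

lemma K_nonneg: "0 \<le> K" using w_nonneg w_le order_trans by blast

lemma clock_pos: "0 < clock" using K_nonneg by (simp add: clock_def add_nonneg_pos)

lemma total_rate_less: "(\<Sum>m\<in>UNIV. w m x) < clock"
  using sum_bounded_above[of UNIV "\<lambda>m. w m x" K] w_le by (simp add: clock_def)

lemma stay_pos: "0 < stay x"
  using total_rate_less[of x] clock_pos by (simp add: stay_def sum_divide_distrib[symmetric])

lemma weight_nonneg: "0 \<le> w m x / clock" using w_nonneg clock_pos by (simp add: less_imp_le)

lemma weights_sum: "(\<Sum>m\<in>UNIV. w m x / clock) + stay x = 1"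
  by (simp add: stay_def)

lemma step_gen: "clock * step f x = clock * f x + gen f x"
proof -
  have "clock * step f x = (\<Sum>m\<in>UNIV. w m x * f (move m x)) + (clock * stay x) * f x"
    using clock_pos by (simp add: step_def distrib_left sum_distrib_left)
  also have "clock * stay x = clock - (\<Sum>m\<in>UNIV. w m x)"
    using clock_pos by (simp add: stay_def right_diff_distrib sum_distrib_left)
  finally show ?thesis
    by (simp add: gen_def algebra_simps sum_subtractf sum_distrib_left)
qed

lemma gen_step: "gen f x = clock * step f x - clock * f x"
  using step_gen[of f x] by simp

lemma step_mono: "(\<And>x. f x \<le> g x) \<Longrightarrow> step f x \<le> step g x"
  unfolding step_def by (intro add_mono sum_mono mult_left_mono weight_nonneg less_imp_le[OF stay_pos])

lemma step_const [simp]: "step (\<lambda>_. a) x = a"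
  unfolding step_def sum_distrib_right[symmetric] distrib_right[symmetric] weights_sum by simp

lemma step_add: "step (\<lambda>x. f x + g x) x = step f x + step g x"
  by (simp add: step_def algebra_simps sum.distrib)

lemma step_mult: "step (\<lambda>x. a * f x) x = a * step f x"
  by (simp add: step_def algebra_simps sum_distrib_left)

lemma step_bounds:
  assumes "\<And>x. a \<le> f x" "\<And>x. f x \<le> b" shows "a \<le> step f x" "step f x \<le> b"
  using step_mono[of "\<lambda>_. a" f x] step_mono[of f "\<lambda>_. b" x] assms by simp_all

lemma step_iterate_bounds:
  assumes "\<And>x. a \<le> f x" "\<And>x. f x \<le> b"
  shows "a \<le> (step ^^ k) f x \<and> (step ^^ k) f x \<le> b"
proof (induction k arbitrary: x)
  case (Suc k)
  show ?case using step_bounds[of a "(step ^^ k) f" b x] Suc by simp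
qed (use assms in simp)

lemma abs_step_le: "\<bar>step f x\<bar> \<le> step (\<lambda>x. \<bar>f x\<bar>) x"
proof (rule abs_leI)
  show "step f x \<le> step (\<lambda>x. \<bar>f x\<bar>) x" by (rule step_mono) simp
  have "- step f x = step (\<lambda>x. (-1) * f x) x" unfolding step_mult by simp
  also have "\<dots> \<le> step (\<lambda>x. \<bar>f x\<bar>) x" by (rule step_mono) simp
  finally show "- step f x \<le> step (\<lambda>x. \<bar>f x\<bar>) x" .
qed

lemma step_tendsto: "(\<And>x. (\<lambda>k. f k x) \<longlonglongrightarrow> g x) \<Longrightarrow> (\<lambda>k. step (f k) x) \<longlonglongrightarrow> step g x"
  unfolding step_def by (intro tendsto_intros)

text \<open>
  The excess of \<open>P f\<^sup>2\<close> over \<open>(P f)\<^sup>2\<close> is the variance of \<open>f\<close> after one step of the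
  chain. Its nonnegativity gives contractivity in mean square, its value controls
  how much \<open>f\<close> differs between neighbours.
\<close>
lemma step_variance:
  "step (\<lambda>x. (f x)\<^sup>2) x - (step f x)\<^sup>2 =
    (\<Sum>m\<in>UNIV. w m x / clock * (f (move m x) - step f x)\<^sup>2) + stay x * (f x - step f x)\<^sup>2"
proof -
  define s where "s = step f x"
  have s: "s = (\<Sum>m\<in>UNIV. w m x / clock * f (move m x)) + stay x * f x" by (simp add: s_def step_def)
  have e: "a * (y - s)\<^sup>2 = a * y\<^sup>2 - 2 * s * (a * y) + s\<^sup>2 * a" for a y :: real
    by (simp add: power2_eq_square algebra_simps)
  have "(\<Sum>m\<in>UNIV. w m x / clock * (f (move m x) - s)\<^sup>2) + stay x * (f x - s)\<^sup>2 =
     step (\<lambda>x. (f x)\<^sup>2) x - 2 * s * s + s\<^sup>2 * ((\<Sum>m\<in>UNIV. w m x / clock) + stay x)"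
    unfolding e sum.distrib sum_subtractf sum_distrib_left[symmetric]
    by (subst (3) s) (simp add: step_def algebra_simps)
  also have "\<dots> = step (\<lambda>x. (f x)\<^sup>2) x - s\<^sup>2"
    by (simp add: weights_sum power2_eq_square)
  finally show ?thesis by (simp add: s_def)
qed

lemma step_variance_nonneg: "(step f x)\<^sup>2 \<le> step (\<lambda>x. (f x)\<^sup>2) x"
proof -
  have "0 \<le> step (\<lambda>x. (f x)\<^sup>2) x - (step f x)\<^sup>2"
    unfolding step_variance
    by (intro add_nonneg_nonneg sum_nonneg mult_nonneg_nonneg weight_nonneg less_imp_le[OF stay_pos]) auto
  thus ?thesis by simp
qed

lemma nn_integral_step:
  assumes "\<And>x. 0 \<le> f x"
  shows "(\<integral>\<^sup>+x. ennreal (step f x) \<partial>M) = (\<integral>\<^sup>+x. ennreal (f x) \<partial>M)"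
proof -
  define h where "h x = ennreal (f x / clock)" for x
  have mov: "ennreal (w m x / clock * f y) = ennreal (w m x) * h y" for m x y
    using w_nonneg assms clock_pos
    by (simp add: h_def ennreal_mult'[symmetric] less_imp_le)
  have nn: "0 \<le> w m x / clock * f y" for m x y
    using weight_nonneg assms by (rule mult_nonneg_nonneg)
  have st: "0 \<le> stay x * f x" for x using stay_pos assms by (simp add: less_imp_le)
  have "(\<integral>\<^sup>+x. ennreal (step f x) \<partial>M) =
      (\<integral>\<^sup>+x. (\<Sum>m\<in>UNIV. ennreal (w m x) * h (move m x)) + ennreal (stay x * f x) \<partial>M)"
    unfolding step_def mov[symmetric] using nn st
    by (intro nn_integral_cong) (simp add: ennreal_plus[symmetric] sum_nonneg sum_ennreal del: ennreal_plus)
  also have "\<dots> = (\<integral>\<^sup>+x. (\<Sum>m\<in>UNIV. ennreal (w m x) * h x) + ennreal (stay x * f x) \<partial>M)"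
    by (simp add: nn_integral_add balance)
  also have "\<dots> = (\<integral>\<^sup>+x. ennreal (f x) \<partial>M)"
  proof (rule nn_integral_cong)
    fix x
    have "(\<Sum>m\<in>UNIV. ennreal (w m x) * h x) + ennreal (stay x * f x) =
        ennreal ((\<Sum>m\<in>UNIV. w m x / clock * f x) + stay x * f x)"
      unfolding mov[symmetric] using nn st
      by (simp add: ennreal_plus[symmetric] sum_nonneg sum_ennreal del: ennreal_plus)
    also have "(\<Sum>m\<in>UNIV. w m x / clock * f x) + stay x * f x = f x"
      unfolding sum_distrib_right[symmetric] distrib_right[symmetric] weights_sum by simp
    finally show "(\<Sum>m\<in>UNIV. ennreal (w m x) * h x) + ennreal (stay x * f x) = ennreal (f x)" .
  qed
  finally show ?thesis .
qed

lemma integral_step: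
  assumes "\<And>x. 0 \<le> f x" and "integrable M f"
  shows "integrable M (step f)" "(\<integral>x. step f x \<partial>M) = (\<integral>x. f x \<partial>M)"
proof -
  have pos: "0 \<le> step f x" for x using step_mono[of "\<lambda>_. 0" f x] assms(1) by simp
  have fin: "(\<integral>\<^sup>+x. ennreal (step f x) \<partial>M) = ennreal (\<integral>x. f x \<partial>M)"
    unfolding nn_integral_step[OF assms(1)]
    by (rule nn_integral_eq_integral) (use assms in auto)
  show "integrable M (step f)"
    by (rule integrableI_nn_integral_finite[OF _ _ fin]) (use pos assms in auto)
  show "(\<integral>x. step f x \<partial>M) = (\<integral>x. f x \<partial>M)"
    using integral_eq_nn_integral[of "step f" M] fin pos assms(1) by simp
qed

text \<open>
  Since \<open>- gen f\<close> is \<open>clock\<close> times \<open>f - P f\<close>, the claim is \<open>\<integral> f (P f) \<le> \<integral> f\<^sup>2\<close>.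
  This follows from \<open>2 f (P f) \<le> f\<^sup>2 + (P f)\<^sup>2 \<le> f\<^sup>2 + P f\<^sup>2\<close>, as \<open>P\<close> preserves
  integrals. Integrability matters in its own right: Bochner integrals of sums split only for
  integrable summands.
\<close>
proposition dirichlet_form_nonneg:
  assumes "f \<in> L2 p"
  shows "integrable M (\<lambda>x. f x * - gen f x)" "0 \<le> inner_prod p f (\<lambda>x. - gen f x)"
proof -
  have f2: "integrable M (\<lambda>x. (f x)\<^sup>2)" using assms by (simp add: L2_def)
  note s2 = integral_step[OF _ f2]
  define d where "d x = (f x)\<^sup>2 - f x * step f x" for x
  have gen: "f x * - gen f x = clock * d x" for x
    unfolding gen_step d_def by (simp add: algebra_simps power2_eq_square)
  have prod: "\<bar>f x * step f x\<bar> \<le> ((f x)\<^sup>2 + step (\<lambda>x. (f x)\<^sup>2) x) / 2" for x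
    using step_variance_nonneg[of f x] sum_squares_bound[of "\<bar>f x\<bar>" "\<bar>step f x\<bar>"]
    by (simp add: abs_mult)
  have int: "integrable M (\<lambda>x. f x * step f x)"
    by (rule Bochner_Integration.integrable_bound[of _ "\<lambda>x. ((f x)\<^sup>2 + step (\<lambda>x. (f x)\<^sup>2) x) / 2"])
      (use f2 s2 prod in \<open>auto intro: order_trans[OF _ abs_ge_self]\<close>)
  have intd: "integrable M d" unfolding d_def using f2 int by auto
  show "integrable M (\<lambda>x. f x * - gen f x)" unfolding gen using intd by simp
  have "(\<integral>x. f x * step f x \<partial>M) \<le> (\<integral>x. ((f x)\<^sup>2 + step (\<lambda>x. (f x)\<^sup>2) x) / 2 \<partial>M)"
    by (rule integral_mono) (use int f2 s2 abs_le_D1[OF prod] in auto)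
  also have "\<dots> = (\<integral>x. (f x)\<^sup>2 \<partial>M)" using f2 s2 by simp
  finally have "0 \<le> (\<integral>x. d x \<partial>M)" unfolding d_def using f2 int by simp
  thus "0 \<le> inner_prod p f (\<lambda>x. - gen f x)" unfolding inner_prod_def gen using clock_pos by simp
qed

section \<open>Uniformisation of the semigroup\<close>

lemma step_linear: "step (\<lambda>x. a * f x + g x) = (\<lambda>x. a * step f x + step g x)"
  by (rule ext) (simp add: step_add step_mult)

lemma gen_linear: "gen (\<lambda>x. a * f x + g x) = (\<lambda>x. a * gen f x + gen g x)"
  by (rule ext) (simp only: gen_step step_add step_mult, simp add: algebra_simps)

lemma gen_iterate_bound:
  assumes "\<And>x. \<bar>f x\<bar> \<le> B"
  shows "\<bar>(gen ^^ k) f x\<bar> \<le> (2 * clock) ^ k * B"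
proof (induction k arbitrary: x)
  case (Suc k)
  let ?g = "(gen ^^ k) f"
  have "\<bar>step ?g x\<bar> \<le> (2 * clock) ^ k * B"
    using abs_step_le[of ?g x] step_bounds(2)[of 0 "\<lambda>x. \<bar>?g x\<bar>" "(2 * clock) ^ k * B" x] Suc
    by fastforce
  hence "\<bar>step ?g x\<bar> + \<bar>?g x\<bar> \<le> 2 * ((2 * clock) ^ k * B)" using Suc[of x] by linarith
  hence "\<bar>step ?g x - ?g x\<bar> \<le> 2 * ((2 * clock) ^ k * B)" by linarith
  hence "clock * \<bar>step ?g x - ?g x\<bar> \<le> clock * (2 * ((2 * clock) ^ k * B))"
    using clock_pos by simp
  moreover have "clock * \<bar>step ?g x - ?g x\<bar> = \<bar>gen ?g x\<bar>"
    using clock_pos unfolding gen_step right_diff_distrib[symmetric] by (simp add: abs_mult)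
  ultimately show ?case by simp
qed (use assms in simp)

text \<open>
  Expanding powers of \<open>P = 1 + gen / clock\<close> in powers of \<open>gen\<close>, rather than the other way
  round, keeps all coefficients positive.
\<close>
lemma step_iterate_expand:
  "clock ^ k * (step ^^ k) f x = (\<Sum>i\<le>k. real (k choose i) * clock ^ (k - i) * (gen ^^ i) f x)"
proof (induction k arbitrary: f)
  case (Suc k)
  have "clock * (step ^^ k) (step f) x = (step ^^ k) (\<lambda>x. clock * step f x + 0) x"
    using step_iterate_bounds[of 0 "\<lambda>_. 0" 0 k x] by (subst funpow_linear[OF step_linear]) simp
  also have "(\<lambda>x. clock * step f x + 0) = (\<lambda>x. clock * f x + gen f x)"
    using step_gen[of f] by auto
  finally have "clock ^ Suc k * (step ^^ Suc k) f x =
      clock ^ k * (step ^^ k) (\<lambda>x. clock * f x + gen f x) x"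
    by (simp add: funpow_Suc_right del: funpow.simps)
  also have "\<dots> = (\<Sum>i\<le>k. real (k choose i) * clock ^ (k - i) *
      (clock * (gen ^^ i) f x + (gen ^^ Suc i) f x))"
    unfolding Suc by (simp add: funpow_linear[OF gen_linear] funpow_Suc_right del: funpow.simps)
  finally show ?case by (simp only: binomial_expansion_step)
qed simp

text \<open>
  Multiplying the exponential series of the generator by the series of \<open>exp (clock * t)\<close> and
  collecting powers of \<open>t\<close> yields, by the binomial expansion, the powers of \<open>P\<close>.
\<close>
proposition exp_semigroup_poisson:
  assumes bound: "\<And>x. \<bar>f x\<bar> \<le> B" and "0 \<le> t"
  shows "exp_semigroup gen t f x =
    (\<Sum>k. exp (- (clock * t)) * (clock * t) ^ k / fact k * (step ^^ k) f x)"
proof -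
  define a where "a i = t ^ i / fact i * (gen ^^ i) f x" for i
  define b where "b i = (clock * t) ^ i / fact i" for i :: nat
  have suma: "summable (\<lambda>i. norm (a i))"
  proof (rule summable_comparison_test')
    show "summable (\<lambda>i. (2 * clock * t) ^ i / fact i * B)"
      using summable_exp[of "2 * clock * t"] by (intro summable_mult2) (simp add: field_simps)
    show "norm (norm (a i)) \<le> (2 * clock * t) ^ i / fact i * B" for i
      using mult_left_mono[OF gen_iterate_bound[OF bound, where k = i and x = x], of "t ^ i / fact i"] \<open>0 \<le> t\<close>
      by (simp add: a_def abs_mult power_mult_distrib mult_ac)
  qed
  have bexp: "b sums exp (clock * t)"
    unfolding b_def using exp_converges[of "clock * t"] by (simp add: field_simps)
  have sumb: "summable (\<lambda>i. norm (b i))"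
    using sums_summable[OF bexp] \<open>0 \<le> t\<close> clock_pos by (simp add: b_def[abs_def] abs_mult)
  have prod: "(\<Sum>i\<le>k. a i * b (k - i)) = (clock * t) ^ k / fact k * (step ^^ k) f x" for k
  proof -
    have "a i * b (k - i) = t ^ k / fact k *
        (real (k choose i) * clock ^ (k - i) * (gen ^^ i) f x)" if "i \<le> k" for i
    proof -
      have "t ^ k = t ^ i * t ^ (k - i)" using that by (simp add: power_add[symmetric])
      thus ?thesis using binomial_fact[OF that, where 'a = real]
        by (simp add: a_def b_def power_mult_distrib)
    qed
    hence "(\<Sum>i\<le>k. a i * b (k - i)) = t ^ k / fact k * (clock ^ k * (step ^^ k) f x)"
      unfolding step_iterate_expand by (simp add: sum_distrib_left)
    thus ?thesis by (simp add: power_mult_distrib)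
  qed
  have "(\<lambda>k. (clock * t) ^ k / fact k * (step ^^ k) f x) sums (suminf a * suminf b)"
    using Cauchy_product_sums[OF suma sumb] unfolding prod .
  from sums_mult[OF this, of "exp (- (clock * t))"]
  have "(\<lambda>k. exp (- (clock * t)) * (clock * t) ^ k / fact k * (step ^^ k) f x) sums
     (exp (- (clock * t)) * (suminf a * exp (clock * t)))"
    by (simp add: sums_unique[OF bexp, symmetric] mult.assoc)
  also have "exp (- (clock * t)) * (suminf a * exp (clock * t)) = suminf a"
    by (simp add: exp_minus)
  finally have "suminf a = (\<Sum>k. exp (- (clock * t)) * (clock * t) ^ k / fact k * (step ^^ k) f x)"
    by (rule sums_unique)
  moreover have "exp_semigroup gen t f x = suminf a" unfolding exp_semigroup_def a_def ..
  ultimately show ?thesis by simp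
qed

corollary trans_prob_poisson:
  assumes "0 \<le> t"
  shows "trans_prob gen t x y =
    (\<Sum>k. exp (- (clock * t)) * (clock * t) ^ k / fact k * (step ^^ k) (indicat_real {y}) x)"
  unfolding trans_prob_def
  by (rule exp_semigroup_poisson[where B = 1, OF _ assms]) (simp add: indicator_def)

lemma step_indicator_bounds:
  "0 \<le> (step ^^ k) (indicat_real {y}) x" "(step ^^ k) (indicat_real {y}) x \<le> 1"
  using step_iterate_bounds[of 0 "indicat_real {y}" 1 k x] by simp_all

lemma integral_point: "(\<integral>x. indicat_real {y} x \<partial>M) = p y"
  and nn_integral_point: "(\<integral>\<^sup>+x. ennreal (indicat_real {y} x) \<partial>M) = ennreal (p y)"
proof -
  have "(\<integral>\<^sup>+x. ennreal (indicat_real {y} x) \<partial>M) = (\<Sum>x\<in>{y}. ennreal (p x) * ennreal (indicat_real {y} x))"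
    unfolding nn_integral_dist_measure by (rule nn_integral_count_space') auto
  thus nn: "(\<integral>\<^sup>+x. ennreal (indicat_real {y} x) \<partial>M) = ennreal (p y)" by simp
  show "(\<integral>x. indicat_real {y} x \<partial>M) = p y"
    by (subst integral_eq_nn_integral) (use nn p_nonneg in auto)
qed

text \<open>
  Each power of \<open>P\<close> preserves \<open>p\<close>, hence so does their Poisson average; all terms are
  nonnegative, so sum and integral may be exchanged.
\<close>
proposition stationary: "stationary_distribution gen p"
  unfolding stationary_distribution_def
proof (intro conjI allI impI)
  fix t :: real and y assume t: "0 \<le> t"
  define r where "r k = exp (- (clock * t)) * (clock * t) ^ k / fact k" for k
  define u where "u k = (step ^^ k) (indicat_real {y})" for k
  have r: "0 \<le> r k" for k using t clock_pos by (simp add: r_def)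
  have rs: "r sums 1" unfolding r_def by (rule poisson_sums)
  have u: "0 \<le> u k x" "u k x \<le> 1" for k x unfolding u_def by (rule step_indicator_bounds)+
  have tp: "trans_prob gen t x y = (\<Sum>k. r k * u k x)" for x
    unfolding trans_prob_poisson[OF t] r_def u_def ..
  have summ: "summable (\<lambda>k. r k * u k x)" for x
    unfolding r_def by (rule poisson_average_summable[where B = 1]) (use u t clock_pos in auto)
  have tp0: "0 \<le> trans_prob gen t x y" for x
    unfolding tp by (intro suminf_nonneg summ mult_nonneg_nonneg r u)
  have nnu: "(\<integral>\<^sup>+x. ennreal (u k x) \<partial>M) = ennreal (p y)" for k
  proof (induction k)
    case (Suc k)
    have "(\<integral>\<^sup>+x. ennreal (step (u k) x) \<partial>M) = ennreal (p y)"
      using Suc nn_integral_step[of "u k"] u by simp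
    thus ?case by (simp add: u_def)
  qed (simp add: u_def nn_integral_point)
  have "(\<integral>\<^sup>+x. ennreal (trans_prob gen t x y) \<partial>M) = (\<integral>\<^sup>+x. (\<Sum>k. ennreal (r k * u k x)) \<partial>M)"
    unfolding tp by (subst suminf_ennreal2) (use r u summ in auto)
  also have "\<dots> = (\<Sum>k. \<integral>\<^sup>+x. ennreal (r k) * ennreal (u k x) \<partial>M)"
    by (subst nn_integral_suminf) (use r u in \<open>auto simp: ennreal_mult\<close>)
  also have "\<dots> = (\<Sum>k. ennreal (r k * p y))"
    by (simp add: nn_integral_cmult nnu ennreal_mult r p_nonneg)
  also have "\<dots> = ennreal (\<Sum>k. r k * p y)"
    by (rule suminf_ennreal2) (use r p_nonneg sums_summable[OF rs] in \<open>auto intro: summable_mult2\<close>)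
  also have "(\<Sum>k. r k * p y) = p y"
    using sums_unique[OF sums_mult2[OF rs, of "p y"]] by simp
  finally have "(\<integral>\<^sup>+x. ennreal (p x * trans_prob gen t x y) \<partial>count_space UNIV) = ennreal (p y)"
    unfolding nn_integral_dist_measure by (simp add: ennreal_mult p_nonneg tp0)
  thus "((\<lambda>x. p x * trans_prob gen t x y) has_sum p y) UNIV"
    by (intro has_sum_nn_integral_count_space) (use p_nonneg tp0 in auto)
qed (use p_nonneg p_sum in auto)

section \<open>Convergence to the invariant distribution\<close>

text \<open>
  By invariance, tested with the indicator of the null states, the mean rate of jumps into null
  states equals the mean rate of jumps out of them, which is \<open>0\<close>.
\<close>
lemma support_closed:
  assumes "0 < p x" "0 < w m x" shows "0 < p (move m x)"
proof -
  define h :: "'s \<Rightarrow> ennreal" where "h y = (if p y = 0 then 1 else 0)" for y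
  have "(\<integral>\<^sup>+x. (\<Sum>m\<in>UNIV. ennreal (w m x) * h (move m x)) \<partial>M) = 0"
    unfolding balance unfolding nn_integral_dist_measure by (subst nn_integral_0_iff_AE) (auto simp: h_def)
  hence "ennreal (p x) * (\<Sum>m\<in>UNIV. ennreal (w m x) * h (move m x)) = 0"
    unfolding nn_integral_dist_measure by (subst (asm) nn_integral_0_iff_AE) (auto simp: AE_count_space)
  hence "ennreal (w m x) * h (move m x) = 0" using assms(1) by (auto simp: sum_nonneg_eq_0_iff)
  hence "h (move m x) = 0" using assms(2) by (simp add: ennreal_eq_0_iff)
  thus ?thesis using p_nonneg[of "move m x"] by (auto simp: h_def split: if_splits)
qed

text \<open>
  The one-step variances of \<open>P\<^sup>k f\<close> integrate to \<open>\<integral> (P\<^sup>k f)\<^sup>2 - \<integral> (P\<^sup>k\<^sup>+\<^sup>1 f)\<^sup>2\<close>,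
  the decrement of a convergent sequence, and the variance at \<open>x\<close> enters that integral
  with the fixed weight \<open>p x > 0\<close>.
\<close>
lemma energy_decay:
  assumes bound: "\<And>x. \<bar>f x\<bar> \<le> B" and x: "0 < p x"
  shows "(\<lambda>k. step (\<lambda>x. ((step ^^ k) f x)\<^sup>2) x - ((step ^^ Suc k) f x)\<^sup>2) \<longlonglongrightarrow> 0"
proof -
  define u where "u k = (step ^^ k) f" for k
  define v where "v k x = step (\<lambda>x. (u k x)\<^sup>2) x - (u (Suc k) x)\<^sup>2" for k x
  define e where "e k = (\<integral>x. (u k x)\<^sup>2 \<partial>M)" for k
  have u: "\<bar>u k x\<bar> \<le> B" for k x
    using step_iterate_bounds[of "- B" f B k x] bound unfolding u_def by (simp add: abs_le_iff minus_le_iff)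
  have u2: "(u k x)\<^sup>2 \<le> B\<^sup>2" for k x using u[of k x] by (metis abs_ge_zero power2_abs power_mono)
  have i: "integrable M (\<lambda>x. (u k x)\<^sup>2)" for k by (rule integrable_bounded[where B = "B\<^sup>2"]) (use u2 in auto)
  note s = integral_step[OF _ i]
  have v0: "0 \<le> v k x" for k x using step_variance_nonneg[of "u k" x] by (simp add: v_def u_def)
  have iv: "integrable M (v k)" for k unfolding v_def using s i by auto
  have ev: "(\<integral>x. v k x \<partial>M) = e k - e (Suc k)" for k
    unfolding v_def e_def using s i by (subst Bochner_Integration.integral_diff) auto
  have "e k - e (Suc k) \<ge> 0" for k
    unfolding ev[symmetric] using v0 by (intro Bochner_Integration.integral_nonneg) auto
  hence dec: "decseq e" by (intro decseq_SucI) simp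
  have "e k \<ge> 0" for k unfolding e_def by simp
  then obtain L where "e \<longlonglongrightarrow> L" using decseq_convergent[OF dec, of 0] by blast
  hence "(\<lambda>k. e k - e (Suc k)) \<longlonglongrightarrow> L - L" by (intro tendsto_diff LIMSEQ_Suc)
  hence lim: "(\<lambda>k. (e k - e (Suc k)) / p x) \<longlonglongrightarrow> 0" by (simp add: tendsto_divide_zero)
  have "v k x * p x = (\<integral>y. v k x * indicat_real {x} y \<partial>M)" for k
    by (simp only: integral_mult_right_zero integral_point)
  also have "\<dots> k \<le> (\<integral>y. v k y \<partial>M)" for k
  proof (rule integral_mono[OF _ iv])
    show "integrable M (\<lambda>y. v k x * indicat_real {x} y)"
      by (rule integrable_bounded[where B = "\<bar>v k x\<bar>"]) (simp add: indicator_def)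
    show "v k x * indicat_real {x} y \<le> v k y" for y using v0 by (simp add: indicator_def)
  qed
  finally have le: "v k x \<le> (e k - e (Suc k)) / p x" for k
    using x unfolding ev by (simp add: field_simps)
  have "(\<lambda>k. v k x) \<longlonglongrightarrow> 0"
    by (rule tendsto_sandwich[OF _ _ tendsto_const lim]) (use v0 le in auto)
  thus ?thesis by (simp add: v_def u_def)
qed

definition edge :: "'s \<Rightarrow> 's \<Rightarrow> bool" where
  "edge x y \<longleftrightarrow> 0 < p x \<and> (\<exists>m. 0 < w m x \<and> y = move m x)"

text \<open>
  A vanishing variance at \<open>x\<close> brings the values of \<open>P\<^sup>k f\<close> at \<open>x\<close> and at all its successors
  close to the common number \<open>P\<^sup>k\<^sup>+\<^sup>1 f x\<close>; that \<open>x\<close> is among its own successors is where the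
  positive holding probability enters. The relation so obtained is symmetric and transitive.
\<close>
lemma step_iterates_merge:
  assumes bound: "\<And>x. \<bar>f x\<bar> \<le> B" and "equivclp edge x y"
  shows "(\<lambda>k. (step ^^ k) f x - (step ^^ k) f y) \<longlonglongrightarrow> 0"
  using assms(2)
proof (induction rule: equivclp_induct)
  case base
  show ?case by simp
next
  case (step y z)
  define u where "u k = (step ^^ k) f" for k
  have merge: "(\<lambda>k. u k a - u k b) \<longlonglongrightarrow> 0" if e: "edge a b" for a b
  proof -
    obtain m where m: "0 < p a" "0 < w m a" "b = move m a"
      using e unfolding edge_def by blast
    define v where "v k = step (\<lambda>x. (u k x)\<^sup>2) a - (u (Suc k) a)\<^sup>2" for k
    have v: "v \<longlonglongrightarrow> 0" unfolding v_def u_def by (rule energy_decay[OF bound m(1)])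
    have close: "(\<lambda>k. u k c - u (Suc k) a) \<longlonglongrightarrow> 0"
      if "0 < q" "\<And>k. q * (u k c - u (Suc k) a)\<^sup>2 \<le> v k" for q c
    proof -
      have "(\<lambda>k. v k / q) \<longlonglongrightarrow> 0" using v by (simp add: tendsto_divide_zero)
      hence "(\<lambda>k. (u k c - u (Suc k) a)\<^sup>2) \<longlonglongrightarrow> 0"
        by (rule tendsto_sandwich[OF _ _ tendsto_const, rotated 2])
          (use that in \<open>auto simp: field_simps\<close>)
      thus ?thesis by simp
    qed
    have vexp: "v k = (\<Sum>m\<in>UNIV. w m a / clock * (u k (move m a) - u (Suc k) a)\<^sup>2)
        + stay a * (u k a - u (Suc k) a)\<^sup>2" for k
      unfolding v_def by (simp add: u_def step_variance)
    have "0 \<le> (\<Sum>m\<in>UNIV. w m a / clock * (u k (move m a) - u (Suc k) a)\<^sup>2)" for k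
      by (intro sum_nonneg mult_nonneg_nonneg weight_nonneg) auto
    hence "(\<lambda>k. u k a - u (Suc k) a) \<longlonglongrightarrow> 0"
      by (intro close[OF stay_pos[of a]]) (simp only: vexp le_add_same_cancel2)
    moreover have "w m a / clock * (u k b - u (Suc k) a)\<^sup>2 \<le> v k" for k
    proof -
      have "w m a / clock * (u k b - u (Suc k) a)\<^sup>2
          \<le> (\<Sum>m\<in>UNIV. w m a / clock * (u k (move m a) - u (Suc k) a)\<^sup>2)"
        unfolding m(3)
        by (rule member_le_sum[where f = "\<lambda>m. w m a / clock * (u k (move m a) - u (Suc k) a)\<^sup>2"])
          (simp_all only: finite UNIV_I mult_nonneg_nonneg[OF weight_nonneg] zero_le_power2)
      moreover have "0 \<le> stay a * (u k a - u (Suc k) a)\<^sup>2" using stay_pos by (simp add: less_imp_le)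
      ultimately show ?thesis by (simp add: vexp)
    qed
    hence "(\<lambda>k. u k b - u (Suc k) a) \<longlonglongrightarrow> 0"
      by (intro close[of "w m a / clock"]) (use m clock_pos in auto)
    ultimately have "(\<lambda>k. (u k a - u (Suc k) a) - (u k b - u (Suc k) a)) \<longlonglongrightarrow> 0 - 0"
      by (rule tendsto_diff)
    thus ?thesis by simp
  qed
  have "(\<lambda>k. u k y - u k z) \<longlonglongrightarrow> 0"
  proof (cases "edge y z")
    case False
    hence "(\<lambda>k. u k z - u k y) \<longlonglongrightarrow> 0" using merge step by auto
    from tendsto_minus[OF this] show ?thesis by simp
  qed (rule merge)
  from tendsto_add[OF step.IH[folded u_def] this] show ?case by (simp add: u_def)
qed

text \<open>
  \<open>P\<^sup>k f x - L\<close> is the \<open>p\<close>-mean over \<open>y\<close> of \<open>P\<^sup>k f x - P\<^sup>k f y\<close>.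
\<close>
lemma step_iterates_converge_on_support:
  assumes bound: "\<And>x. \<bar>f x\<bar> \<le> B"
    and connected: "\<And>x y. 0 < p x \<Longrightarrow> 0 < p y \<Longrightarrow> equivclp edge x y"
    and inv: "\<And>k. (\<integral>x. (step ^^ k) f x \<partial>M) = L" and x: "0 < p x"
  shows "(\<lambda>k. (step ^^ k) f x) \<longlonglongrightarrow> L"
proof -
  define u where "u k = (step ^^ k) f" for k
  have u: "\<bar>u k x\<bar> \<le> B" for k x
    using step_iterate_bounds[of "- B" f B k x] bound unfolding u_def by (simp add: abs_le_iff minus_le_iff)
  have "(\<lambda>k. \<integral>y. u k x - u k y \<partial>M) \<longlonglongrightarrow> (\<integral>y. 0 \<partial>M)"
  proof (rule integral_dominated_convergence[where w = "\<lambda>_. 2 * B"])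
    show "AE y in M. (\<lambda>k. u k x - u k y) \<longlonglongrightarrow> 0"
      unfolding AE_M u_def by (intro allI impI step_iterates_merge[OF bound] connected x)
    show "AE y in M. norm (u k x - u k y) \<le> 2 * B" for k
    proof (rule AE_I2)
      show "norm (u k x - u k y) \<le> 2 * B" for y using u[of k x] u[of k y] by simp
    qed
  qed (simp_all only: measurable_dist_measure integrable_bounded[OF order_refl])
  also have "(\<lambda>k. \<integral>y. u k x - u k y \<partial>M) = (\<lambda>k. u k x - L)"
  proof
    fix k
    have "(\<integral>y. u k x - u k y \<partial>M) = (\<integral>y. u k x \<partial>M) - (\<integral>y. u k y \<partial>M)"
      by (rule Bochner_Integration.integral_diff) (rule integrable_bounded, rule u)+
    thus "(\<integral>y. u k x - u k y \<partial>M) = u k x - L"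
      by (simp add: measure_M inv u_def)
  qed
  finally have "(\<lambda>k. u k x - L) \<longlonglongrightarrow> 0" by simp
  thus ?thesis by (simp add: u_def LIM_zero_iff)
qed

text \<open>
  \<open>1 - q\<close> is a lower bound for the probability that the chain leaves the null states in one step,
  and it cannot come back by \<open>support_closed\<close>.
\<close>
lemma transient_mass_decay:
  assumes q: "0 \<le> q"
    and exit: "\<And>x. p x = 0 \<Longrightarrow> \<exists>m. 1 - q \<le> w m x / clock \<and> 0 < p (move m x)"
  shows "(step ^^ j) (\<lambda>x. of_bool (p x = 0)) x \<le> q ^ j * of_bool (p x = 0)"
proof -
  define T where "T = (\<lambda>x. of_bool (p x = 0) :: real)"
  have one: "step T x \<le> q * T x" for x
  proof (cases "p x = 0")
    case True
    then obtain m where m: "1 - q \<le> w m x / clock" "0 < p (move m x)" using exit by blast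
    have T1: "0 \<le> 1 - T y" for y by (simp add: T_def)
    have "w m x / clock * (1 - T (move m x)) \<le> (\<Sum>m\<in>UNIV. w m x / clock * (1 - T (move m x)))"
      by (rule member_le_sum[where f = "\<lambda>m. w m x / clock * (1 - T (move m x))"])
        (simp_all only: finite UNIV_I mult_nonneg_nonneg[OF weight_nonneg] T1)
    moreover have "0 \<le> stay x * (1 - T x)" using stay_pos[of x] by (simp add: T_def)
    ultimately have "w m x / clock * (1 - T (move m x)) \<le> step (\<lambda>y. 1 - T y) x"
      by (simp add: step_def)
    also have "step (\<lambda>y. 1 - T y) x = step (\<lambda>y. (-1) * T y + 1) x" by simp
    also have "\<dots> = 1 - step T x" unfolding step_linear by simp
    finally show ?thesis using m True by (simp add: T_def)
  next
    case False
    hence x: "0 < p x" using p_nonneg[of x] by linarith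
    have "w m x / clock * T (move m x) = 0" for m
      using support_closed[OF x, of m] w_nonneg[of m x] by (cases "w m x = 0") (auto simp: T_def)
    hence "step T x = stay x * T x" unfolding step_def by (simp only: sum.neutral_const add_0)
    thus ?thesis using False by (simp add: T_def)
  qed
  have "(step ^^ j) T x \<le> q ^ j * T x" for x
  proof (induction j arbitrary: x)
    case (Suc j)
    have "step ((step ^^ j) T) x \<le> step (\<lambda>x. q ^ j * T x) x" using Suc by (rule step_mono)
    also have "\<dots> \<le> q ^ j * (q * T x)"
      unfolding step_mult using one q by (intro mult_left_mono) auto
    finally show ?case by (simp add: mult_ac)
  qed simp
  thus ?thesis by (simp add: T_def)
qed

lemma abs_step_iterate_le: "\<bar>(step ^^ j) f x\<bar> \<le> (step ^^ j) (\<lambda>x. \<bar>f x\<bar>) x"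
proof (induction j arbitrary: x)
  case (Suc j)
  have "\<bar>step ((step ^^ j) f) x\<bar> \<le> step (\<lambda>x. \<bar>(step ^^ j) f x\<bar>) x" by (rule abs_step_le)
  also have "\<dots> \<le> step ((step ^^ j) (\<lambda>x. \<bar>f x\<bar>)) x" using Suc by (rule step_mono)
  finally show ?case by simp
qed simp

lemma step_iterate_mono: "(\<And>x. f x \<le> g x) \<Longrightarrow> (step ^^ j) f x \<le> (step ^^ j) g x"
proof (induction j arbitrary: x)
  case (Suc j)
  show ?case using step_mono[OF Suc.IH[OF Suc.prems]] by simp
qed simp

lemma step_iterate_tendsto:
  "(\<And>x. (\<lambda>k. f k x) \<longlonglongrightarrow> g x) \<Longrightarrow> (\<lambda>k. (step ^^ j) (f k) x) \<longlonglongrightarrow> (step ^^ j) g x"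
proof (induction j arbitrary: x)
  case (Suc j)
  show ?case using step_tendsto[OF Suc.IH[OF Suc.prems]] by simp
qed simp

lemma step_iterate_const: "(step ^^ j) (\<lambda>_. a) x = a"
  using step_iterate_bounds[of a "\<lambda>_. a" a j x] by simp

text \<open>
  Run the chain \<open>j\<close> steps from an arbitrary state. With probability at least \<open>1 - q\<^sup>j\<close> it
  has reached the support, where the claim holds; only finitely many states can be reached in \<open>j\<close>
  steps, so pointwise convergence there suffices.
\<close>
proposition step_iterates_converge:
  assumes bound: "\<And>x. \<bar>f x\<bar> \<le> B"
    and support: "\<And>x. 0 < p x \<Longrightarrow> (\<lambda>k. (step ^^ k) f x) \<longlonglongrightarrow> L"
    and d: "0 < d" and exit: "\<And>x. p x = 0 \<Longrightarrow> \<exists>m. d \<le> w m x \<and> 0 < p (move m x)"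
  shows "(\<lambda>k. (step ^^ k) f x) \<longlonglongrightarrow> L"
proof (rule LIMSEQ_I)
  fix e :: real assume e: "0 < e"
  \<comment> \<open>The maximum matters when there are no null states: then \<open>d\<close> may exceed \<open>clock\<close>.\<close>
  define q where "q = max 0 (1 - d / clock)"
  define T where "T = (\<lambda>x. of_bool (p x = 0) :: real)"
  define C where "C = B + \<bar>L\<bar>"
  have q: "0 \<le> q" "q < 1" using d clock_pos by (auto simp: q_def)
  have "\<exists>m. 1 - q \<le> w m x / clock \<and> 0 < p (move m x)" if x: "p x = 0" for x
  proof -
    obtain m where m: "d \<le> w m x" "0 < p (move m x)" using exit[OF x] by blast
    have "1 - q \<le> d / clock" by (simp add: q_def)
    also have "\<dots> \<le> w m x / clock" using m clock_pos by (simp add: divide_right_mono)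
    finally show ?thesis using m by blast
  qed
  note decay = transient_mass_decay[OF q(1) this, folded T_def]
  have C: "0 \<le> C" using bound[of x] by (simp add: C_def)
  have dist: "\<bar>(step ^^ k) f y - L\<bar> \<le> C" for k y
    using step_iterate_bounds[of "- B" f B k y] bound
    by (simp add: abs_le_iff minus_le_iff C_def) linarith
  have "(\<lambda>j. C * q ^ j) \<longlonglongrightarrow> C * 0" using q by (intro tendsto_intros LIMSEQ_power_zero) auto
  then obtain j where j: "C * q ^ j < e / 2"
    using order_tendstoD(2)[of _ "C * 0" sequentially "e / 2"] e
    by (auto simp: eventually_sequentially)
  define h where "h k y = \<bar>(step ^^ k) f y - L\<bar> * (1 - T y)" for k y
  have h: "(\<lambda>k. h k y) \<longlonglongrightarrow> 0" for y
  proof (cases "p y = 0")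
    case False
    hence "(\<lambda>k. (step ^^ k) f y) \<longlonglongrightarrow> L" using p_nonneg[of y] by (intro support) simp
    from tendsto_rabs_zero[OF LIM_zero[OF this]] False show ?thesis by (simp add: h_def T_def)
  qed (simp add: h_def T_def)
  have "(\<lambda>k. (step ^^ j) (h k) x) \<longlonglongrightarrow> 0"
    using step_iterate_tendsto[of h "\<lambda>_. 0", OF h] by (simp add: step_iterate_const)
  then obtain k0 where k0: "\<And>k. k0 \<le> k \<Longrightarrow> (step ^^ j) (h k) x < e / 2"
    using order_tendstoD(2)[of _ 0 sequentially "e / 2"] e by (auto simp: eventually_sequentially)
  show "\<exists>n0. \<forall>k\<ge>n0. norm ((step ^^ k) f x - L) < e"
  proof (intro exI allI impI)
    fix k assume "j + k0 \<le> k"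
    then obtain i where k: "k = j + i" and i: "k0 \<le> i"
      by (intro that[of "k - j"]) auto
    let ?g = "\<lambda>y. (step ^^ i) f y - L"
    have "(step ^^ k) f x - L = (step ^^ j) (\<lambda>y. 1 * (step ^^ i) f y + (- L)) x"
      by (simp only: funpow_linear[OF step_linear] step_iterate_const) (simp add: k funpow_add)
    also have "\<bar>\<dots>\<bar> \<le> (step ^^ j) (\<lambda>y. \<bar>?g y\<bar>) x"
      by (rule order_trans[OF abs_step_iterate_le]) simp
    also have "\<dots> \<le> (step ^^ j) (\<lambda>y. C * T y + h i y) x"
      by (rule step_iterate_mono) (use dist in \<open>auto simp: h_def T_def\<close>)
    also have "\<dots> = C * (step ^^ j) T x + (step ^^ j) (h i) x"
      by (simp only: funpow_linear[OF step_linear])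
    also have "C * (step ^^ j) T x \<le> C * q ^ j"
    proof (rule mult_left_mono[OF _ C])
      have "(step ^^ j) T x \<le> q ^ j * T x" using decay by (simp add: T_def)
      also have "\<dots> \<le> q ^ j" using q by (simp add: T_def)
      finally show "(step ^^ j) T x \<le> q ^ j" .
    qed
    finally show "norm ((step ^^ k) f x - L) < e" using j k0[OF i] by simp
  qed
qed

text \<open>
  Null states are allowed: a uniform rate of escape from them into the support replaces
  irreducibility on the whole space.
\<close>
theorem ergodic_gen:
  assumes connected: "\<And>x y. 0 < p x \<Longrightarrow> 0 < p y \<Longrightarrow> equivclp edge x y"
    and d: "0 < d" and exit: "\<And>x. p x = 0 \<Longrightarrow> \<exists>m. d \<le> w m x \<and> 0 < p (move m x)"
  shows "ergodic gen"
  unfolding ergodic_def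
proof (intro exI conjI allI)
  show "stationary_distribution gen p" by (rule stationary)
  fix x y :: 's
  define f where "f = indicat_real {y}"
  have f: "\<bar>f x\<bar> \<le> 1" for x by (simp add: f_def indicator_def)
  have inv: "(\<integral>x. (step ^^ k) f x \<partial>M) = p y" for k
  proof (induction k)
    case (Suc k)
    have "(\<integral>x. step ((step ^^ k) f) x \<partial>M) = (\<integral>x. (step ^^ k) f x \<partial>M)"
      by (rule integral_step(2))
        (use step_indicator_bounds in \<open>auto simp: f_def intro: integrable_bounded[where B = 1]\<close>)
    thus ?case using Suc by simp
  qed (simp only: f_def funpow_0 integral_point)
  have lim: "(\<lambda>k. (step ^^ k) f x) \<longlonglongrightarrow> p y"
    by (rule step_iterates_converge[OF f _ d exit])
      (rule step_iterates_converge_on_support[OF f connected inv])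
  have bnd: "\<bar>(step ^^ k) f x\<bar> \<le> 1" for k using step_indicator_bounds[of k y x] by (simp add: f_def)
  have "filterlim (\<lambda>t. clock * t) at_top at_top"
    by (rule filterlim_tendsto_pos_mult_at_top[OF tendsto_const clock_pos filterlim_ident])
  from filterlim_compose[OF poisson_average_tendsto[OF bnd lim] this]
  show "((\<lambda>t. trans_prob gen t x y) \<longlongrightarrow> p y) at_top"
    by (rule Lim_transform_eventually)
      (use eventually_ge_at_top[of 0] in eventually_elim, simp add: trans_prob_poisson f_def)
qed

end

section \<open>Splitting the network generator\<close>

datatype 'j move = Arrival 'j | Departure 'j | Switch "'j set"

lemma UNIV_move: "UNIV = range Arrival \<union> range Departure \<union> range Switch"
proof -
  have "m \<in> range Arrival \<union> range Departure \<union> range Switch" for m :: "'j move"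
    by (cases m) auto
  thus ?thesis by blast
qed

instance move :: (finite) finite
  by standard (simp add: UNIV_move)

lemma sum_move:
  fixes f :: "'j::finite move \<Rightarrow> 'a::comm_monoid_add"
  shows "(\<Sum>m\<in>UNIV. f m) = (\<Sum>i\<in>UNIV. f (Arrival i)) + (\<Sum>i\<in>UNIV. f (Departure i)) + (\<Sum>H\<in>UNIV. f (Switch H))"
  unfolding UNIV_move
  by (subst sum.union_disjoint; (subst sum.union_disjoint)?) (auto simp: sum.reindex inj_def)

fun bd_rate :: "'j network \<Rightarrow> 'j move \<Rightarrow> 'j state \<Rightarrow> real" where
  "bd_rate N (Arrival i) (D, n) = (if i \<in> D then 0 else arr N * route N D None (Some i))"
| "bd_rate N (Departure i) (D, n) = (if i \<in> D then 0 else mu N i (n i) * route N D (Some i) None)"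
| "bd_rate N (Switch H) (D, n) = qY N D H"

fun bd_move :: "'j move \<Rightarrow> 'j state \<Rightarrow> 'j state" where
  "bd_move (Arrival i) (D, n) = (D, inc i n)"
| "bd_move (Departure i) (D, n) = (D, dec i n)"
| "bd_move (Switch H) (D, n) = (H, n)"

definition transfer_prob :: "'j network \<Rightarrow> 'j set \<Rightarrow> 'j \<Rightarrow> 'j \<Rightarrow> real" where
  "transfer_prob N D j i = (if j \<in> D \<or> i \<in> D then 0 else route N D (Some j) (Some i))"

fun transfer_rate :: "'j network \<Rightarrow> 'j \<times> 'j \<Rightarrow> 'j state \<Rightarrow> real" where
  "transfer_rate N (j, i) (D, n) = mu N j (n j) * transfer_prob N D j i"

fun transfer_move :: "'j \<times> 'j \<Rightarrow> 'j state \<Rightarrow> 'j state" where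
  "transfer_move (j, i) (D, n) = (D, inc i (dec j n))"

text \<open>
  Services that do not end in a departure are fed back to the same node instead of being dropped:
  this keeps the rows stochastic without altering entrances and departures.
\<close>
definition bd_network :: "'j network \<Rightarrow> 'j network" where
  "bd_network N = N\<lparr>route := \<lambda>D u v. case (u, v) of
     (Some j, Some i) \<Rightarrow> (if i = j then 1 - route N D (Some j) None else 0)
   | _ \<Rightarrow> route N D u v\<rparr>"

lemma bd_network_sel [simp]:
  "arr (bd_network N) = arr N" "mu (bd_network N) = mu N" "eta (bd_network N) = eta N"
  "brk (bd_network N) = brk N" "rep (bd_network N) = rep N"
  "route (bd_network N) D None v = route N D None v"
  "route (bd_network N) D u None = route N D u None"
  "route (bd_network N) D (Some j) (Some i) = (if i = j then 1 - route N D (Some j) None else 0)"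
  by (auto simp: bd_network_def split: option.split)

lemma dec_inc [simp]: "dec i (inc i n) = n"
  by (simp add: inc_def dec_def)

lemma inc_dec: "0 < n i \<Longrightarrow> inc i (dec i n) = n"
  by (simp add: inc_def dec_def)

lemma sum_compl: "(\<Sum>j\<in>- D. f j) = (\<Sum>j\<in>UNIV. if j \<in> D then 0 else f j)"
  for D :: "'j::finite set" and f :: "'j \<Rightarrow> real"
  by (rule sum.mono_neutral_cong_left) auto

lemma QY_eq: "QY N h D = (\<Sum>H\<in>UNIV. qY N D H * (h H - h D))"
proof -
  have "(\<Sum>H\<in>UNIV. qY N D H * (h H - h D)) =
      (\<Sum>H\<in>{H. H \<subset> D} \<union> {I. D \<subset> I}. qY N D H * (h H - h D))"
    by (rule sum.mono_neutral_right) (auto simp: qY_def)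
  also have "\<dots> = QY N h D"
    unfolding QY_def by (rule sum.union_disjoint) auto
  finally show ?thesis by simp
qed

lemma qY_bd_network [simp]: "qY (bd_network N) = qY N"
  by (simp add: qY_def fun_eq_iff)

lemma gen_bd_eq:
  "(\<Sum>m\<in>UNIV. bd_rate N m (D, n) * (f (bd_move m (D, n)) - f (D, n))) =
     (\<Sum>j\<in>- D. arr N * route N D None (Some j) * (f (D, inc j n) - f (D, n)))
   + (\<Sum>j\<in>- D. mu N j (n j) * route N D (Some j) None * (f (D, dec j n) - f (D, n)))
   + QY N (\<lambda>E. f (E, n)) D"
  unfolding sum_move sum_compl QY_eq bd_rate.simps bd_move.simps
  by (intro arg_cong2[where f = "(+)"] sum.cong) auto

lemma sum_pairs: "(\<Sum>m\<in>UNIV. g m) = (\<Sum>j\<in>UNIV. \<Sum>i\<in>UNIV. g (j, i))"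
  by (simp add: sum.cartesian_product)

lemma gen_transfer_eq:
  fixes N :: "'j::finite network"
  shows
  "(\<Sum>m\<in>UNIV. transfer_rate N m (D, n) * (f (transfer_move m (D, n)) - f (D, n))) =
   (\<Sum>j\<in>- D. mu N j (n j) *
        (\<Sum>i\<in>- D. route N D (Some j) (Some i) * (f (D, inc i (dec j n)) - f (D, n))))"
  unfolding sum_pairs sum_compl
proof (rule sum.cong[OF refl])
  fix j
  show "(\<Sum>i\<in>UNIV. transfer_rate N (j, i) (D, n) * (f (transfer_move (j, i) (D, n)) - f (D, n))) =
    (if j \<in> D then 0 else mu N j (n j) * (\<Sum>i\<in>UNIV. if i \<in> D then 0
       else route N D (Some j) (Some i) * (f (D, inc i (dec j n)) - f (D, n))))"
    unfolding sum_distrib_left by (cases "j \<in> D") (auto simp: transfer_prob_def intro: sum.cong)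
qed

lemma QZ_decompose:
  "QZ N f x = (\<Sum>m\<in>UNIV. bd_rate N m x * (f (bd_move m x) - f x)) +
    (\<Sum>m\<in>UNIV. transfer_rate N m x * (f (transfer_move m x) - f x))"
  by (cases x) (simp only: gen_bd_eq gen_transfer_eq, simp add: QZ_def)

text \<open>
  Feeding a customer back to its own node does not change the state, except formally at an empty
  queue, where the service rate is \<open>0\<close>.
\<close>
lemma QZ_bd_network:
  assumes "\<And>j. mu N j 0 = 0"
  shows "QZ (bd_network N) f x = (\<Sum>m\<in>UNIV. bd_rate N m x * (f (bd_move m x) - f x))"
proof (cases x)
  case (Pair D n)
  have "mu N j (n j) * (\<Sum>i\<in>- D. (if i = j then 1 - route N D (Some j) None else 0) *
          (f (D, inc i (dec j n)) - f (D, n))) = 0" for j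
    using assms[of j] inc_dec[of n j]
    by (cases "n j = 0") (auto intro!: sum.neutral)
  hence "(\<Sum>j\<in>- D. mu N j (n j) * (\<Sum>i\<in>- D. (if i = j then 1 - route N D (Some j) None else 0) *
          (f (D, inc i (dec j n)) - f (D, n)))) = 0"
    by (simp only: sum.neutral_const)
  thus ?thesis unfolding Pair gen_bd_eq by (simp add: QZ_def QY_eq)
qed

text \<open>
  If \<open>B\<close> vanished anywhere, it would vanish at the set of all nodes. Then no repair starts once all
  nodes are down, and every state \<open>(UNIV, n)\<close> is absorbing.
\<close>
lemma ergodic_imp_rep_pos:
  fixes N :: "'j::finite network"
  assumes "breakdown_repair N" and "ergodic (QZ N)"
  shows "0 < rep N D"
proof (rule ccontr)
  assume "\<not> 0 < rep N D"
  hence "rep N D = 0" using assms(1) by (auto simp: breakdown_repair_def intro: antisym)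
  hence rep: "rep N UNIV = 0"
    using assms(1) by (cases "D = UNIV") (auto simp: breakdown_repair_def psubset_eq)
  have "QZ N f (UNIV, n) = 0" for f n
    by (auto simp: QZ_def QY_eq qY_def rep intro!: sum.neutral)
  hence "\<not> ergodic (QZ N)"
    by (intro absorbing_not_ergodic[of _ "(UNIV, \<lambda>_. 0)" "(UNIV, \<lambda>_. 1)"]) (auto simp: fun_eq_iff)
  with assms(2) show False by simp
qed

section \<open>The invariant distribution\<close>

locale balanced_network =
  fixes N :: "'j::finite network"
  assumes jackson: "jackson_network N" and breakdown: "breakdown_repair N" and rerouting: "rerouting N"
    and rep_pos: "0 < rep N D"
    and entrance_departure_pos: "pi_hat N D > 0 \<Longrightarrow> i \<in> - D \<Longrightarrow>
           route N D None (Some i) > 0 \<and> route N D (Some i) None > 0"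
    and overall: "overall_balance N D"
begin

lemma arr_pos: "0 < arr N" and mu_0: "mu N j 0 = 0" and mu_pos: "1 \<le> k \<Longrightarrow> 0 < mu N j k"
  using jackson by (auto simp: jackson_network_def)

lemma mu_nonneg: "0 \<le> mu N j k"
  using mu_0 mu_pos[of k] by (cases k) (auto intro: less_imp_le)

lemma route_nonneg: "u \<in> up_nodes0 D \<Longrightarrow> v \<in> up_nodes0 D \<Longrightarrow> 0 \<le> route N D u v"
  using rerouting by (auto simp: rerouting_def stochastic_on_def)

lemma route_row: "u \<in> up_nodes0 D \<Longrightarrow> route N D u None + (\<Sum>i\<in>- D. route N D u (Some i)) = 1"
proof -
  assume "u \<in> up_nodes0 D"
  hence "(\<Sum>v\<in>up_nodes0 D. route N D u v) = 1"
    using rerouting by (auto simp: rerouting_def stochastic_on_def)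
  thus ?thesis by (simp add: up_nodes0_def sum.reindex)
qed

lemma route_le_1: "u \<in> up_nodes0 D \<Longrightarrow> v \<in> up_nodes0 D \<Longrightarrow> route N D u v \<le> 1"
proof -
  assume uv: "u \<in> up_nodes0 D" "v \<in> up_nodes0 D"
  have "route N D u v \<le> (\<Sum>v\<in>up_nodes0 D. route N D u v)"
    using uv route_nonneg by (intro member_le_sum) auto
  also have "\<dots> = 1" using uv rerouting by (auto simp: rerouting_def stochastic_on_def)
  finally show ?thesis .
qed

lemma up_nodes0_simps [simp]: "None \<in> up_nodes0 D" "Some j \<in> up_nodes0 D \<longleftrightarrow> j \<notin> D"
  by (auto simp: up_nodes0_def)

text \<open>
  Overall balance replaces the inflow from other nodes in the traffic equation by the outflow to
  other nodes, so the remaining exchange with the outside balances node by node. This makes the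
  birth-death dynamics reversible.
\<close>
lemma entrance_departure_balance:
  assumes "j \<notin> D" shows "arr N * route N D None (Some j) = eta N j * route N D (Some j) None"
proof -
  have "eta N j = arr N * route N D None (Some j) + (\<Sum>i\<in>- D. eta N i * route N D (Some i) (Some j))"
    using rerouting assms unfolding rerouting_def traffic_def by blast
  also have "(\<Sum>i\<in>- D. eta N i * route N D (Some i) (Some j)) = eta N j * (\<Sum>i\<in>- D. route N D (Some j) (Some i))"
    using overall[of D] assms by (simp add: overall_balance_def)
  also have "(\<Sum>i\<in>- D. route N D (Some j) (Some i)) = 1 - route N D (Some j) None"
    using route_row[of "Some j" D] assms by simp
  finally show ?thesis unfolding right_diff_distrib by linarith
qed

lemma weight_pos: "0 < (\<Sum>E\<in>UNIV. brk N E / rep N E)"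
proof (rule sum_pos2[of _ "{}"])
  show "0 < brk N {} / rep N {}" using breakdown by (simp add: breakdown_repair_def)
  show "0 \<le> brk N E / rep N E" for E
    using breakdown rep_pos[of E] by (simp add: breakdown_repair_def)
qed auto

lemma brk_nonneg: "0 \<le> brk N D" and brk_empty: "brk N {} = 1" and rep_empty: "rep N {} = 1"
  and brk_mono: "D \<subset> I \<Longrightarrow> brk N D = 0 \<Longrightarrow> brk N I = 0"
  using breakdown by (auto simp: breakdown_repair_def)

lemma pi_hat_nonneg: "0 \<le> pi_hat N D"
  using weight_pos brk_nonneg rep_pos[of D] by (simp add: pi_hat_def less_imp_le)

lemma pi_hat_pos_iff: "0 < pi_hat N D \<longleftrightarrow> 0 < brk N D"
  using weight_pos rep_pos[of D] brk_nonneg[of D]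
  by (auto simp: pi_hat_def zero_less_divide_iff zero_less_mult_iff)

lemma pi_hat_sum: "(\<Sum>D\<in>UNIV. pi_hat N D) = 1"
  unfolding pi_hat_def sum_distrib_left[symmetric] using weight_pos by simp

lemma qY_nonneg: "0 \<le> qY N D H"
  using brk_nonneg rep_pos by (simp add: qY_def less_imp_le)

text \<open>
  Up to normalisation both flows between \<open>D \<subset> I\<close> equal \<open>A(I) / B(D)\<close>. If \<open>A(D) = 0\<close>, this
  is \<open>0\<close> because then \<open>A(I) = 0\<close>.
\<close>
lemma qY_reversible: "pi_hat N D * qY N D H = pi_hat N H * qY N H D"
  using brk_mono[of D H] brk_mono[of H D] rep_pos[of D] rep_pos[of H]
  by (cases "brk N D = 0"; cases "brk N H = 0") (auto simp: pi_hat_def qY_def)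

lemma eta_pos: "0 < eta N j"
proof -
  have "0 < route N {} None (Some j)" "0 < route N {} (Some j) None"
    using entrance_departure_pos[of "{}" j] by (simp_all add: pi_hat_pos_iff brk_empty)
  moreover from this have "0 < arr N * route N {} None (Some j)" using arr_pos by simp
  ultimately show ?thesis
    using entrance_departure_balance[of j "{}"] by (simp add: zero_less_mult_iff)
qed

lemma service_weight_Suc: "service_weight N j (Suc m) * mu N j (Suc m) = eta N j * service_weight N j m"
  using mu_pos[of "Suc m" j] by (simp add: service_weight_def)

lemma service_weight_pos: "0 < service_weight N j m"
  unfolding service_weight_def using eta_pos mu_pos by (intro prod_pos) auto

lemma summable_service_weight: "summable (service_weight N j)"
  using jackson by (simp add: jackson_network_def)

lemma norm_const_pos: "0 < norm_const N j"
  unfolding norm_const_def by (intro suminf_pos summable_service_weight service_weight_pos)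

lemma pi_queue_pos: "0 < pi_queue N n"
  unfolding pi_queue_def using norm_const_pos service_weight_pos by (intro prod_pos) auto

lemma pi_queue_inc: "pi_queue N (inc i n) * mu N i (Suc (n i)) = eta N i * pi_queue N n"
proof -
  let ?f = "\<lambda>n j. inverse (norm_const N j) * service_weight N j (n j)"
  have "pi_queue N (inc i n) = ?f (inc i n) i * (\<Prod>j\<in>UNIV - {i}. ?f (inc i n) j)"
    unfolding pi_queue_def by (rule prod.remove) auto
  also have "(\<Prod>j\<in>UNIV - {i}. ?f (inc i n) j) = (\<Prod>j\<in>UNIV - {i}. ?f n j)"
    by (rule prod.cong) (auto simp: inc_def)
  moreover have "inc i n i = Suc (n i)" by (simp add: inc_def)
  ultimately have "pi_queue N (inc i n) * mu N i (Suc (n i)) =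
      inverse (norm_const N i) * (service_weight N i (Suc (n i)) * mu N i (Suc (n i))) * (\<Prod>j\<in>UNIV - {i}. ?f n j)"
    by (simp only: mult_ac)
  also have "\<dots> = eta N i * (?f n i * (\<Prod>j\<in>UNIV - {i}. ?f n j))"
    unfolding service_weight_Suc by simp
  also have "?f n i * (\<Prod>j\<in>UNIV - {i}. ?f n j) = pi_queue N n"
    unfolding pi_queue_def by (rule prod.remove[symmetric]) auto
  finally show ?thesis .
qed

lemma pi_queue_sum: "(pi_queue N has_sum 1) UNIV"
proof -
  let ?f = "\<lambda>j m. inverse (norm_const N j) * service_weight N j m"
  have pos: "0 \<le> ?f j m" for j m using norm_const_pos service_weight_pos by (simp add: less_imp_le)
  have "?f j sums 1" for j
    using sums_mult[OF summable_sums[OF summable_service_weight[of j]], of "inverse (norm_const N j)"] norm_const_pos[of j]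
    by (simp add: norm_const_def[symmetric])
  hence hs: "(?f j has_sum 1) UNIV" for j
    by (rule sums_nonneg_imp_has_sum) (use pos in auto)
  hence abs: "Infinite_Sum.abs_summable_on (?f j) UNIV" for j
    using has_sum_imp_summable pos by fastforce
  have P: "PiE UNIV (\<lambda>_. UNIV) = (UNIV :: ('j \<Rightarrow> nat) set)" by auto
  have "Infinite_Set_Sum.abs_summable_on (\<lambda>n. \<Prod>j\<in>UNIV. ?f j (n j)) (PiE UNIV (\<lambda>_. UNIV))"
    by (rule abs_summable_on_prod_PiE) (simp_all only: finite countableI_type abs_summable_equivalent[THEN iffD1, OF abs])
  hence "pi_queue N summable_on UNIV"
    unfolding P abs_summable_equivalent[symmetric] pi_queue_def[abs_def]
    by (rule Infinite_Sum.abs_summable_summable)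
  moreover have "infsum (\<lambda>n. \<Prod>j\<in>UNIV. ?f j (n j)) (PiE UNIV (\<lambda>_. UNIV)) = (\<Prod>j\<in>UNIV. infsum (?f j) UNIV)"
    by (rule infsum_prod_PiE_abs) (use abs in auto)
  hence "infsum (pi_queue N) UNIV = 1"
    unfolding P pi_queue_def[abs_def] infsumI[OF hs] by simp
  ultimately show ?thesis by (simp add: has_sum_iff)
qed

lemma pi_tilde_nonneg: "0 \<le> pi_tilde N x"
  using pi_hat_nonneg pi_queue_pos by (cases x) (simp add: pi_tilde_def less_imp_le)

lemma pi_tilde_pos_iff: "0 < pi_tilde N (D, n) \<longleftrightarrow> 0 < brk N D"
  using pi_queue_pos[of n] by (simp add: pi_tilde_def pi_hat_pos_iff zero_less_mult_iff)

lemma nn_integral_pi_tilde: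
  "(\<integral>\<^sup>+x. h x \<partial>dist_measure (pi_tilde N)) =
   (\<integral>\<^sup>+n. ennreal (pi_queue N n) * (\<Sum>D\<in>UNIV. ennreal (pi_hat N D) * h (D, n)) \<partial>count_space UNIV)"
proof -
  have "(\<integral>\<^sup>+x. h x \<partial>dist_measure (pi_tilde N)) =
     (\<integral>\<^sup>+n. \<integral>\<^sup>+D. ennreal (pi_tilde N (D, n)) * h (D, n) \<partial>count_space UNIV \<partial>count_space UNIV)"
    unfolding nn_integral_dist_measure by (rule nn_integral_snd_count_space[symmetric])
  also have "\<dots> = (\<integral>\<^sup>+n. ennreal (pi_queue N n) * (\<Sum>D\<in>UNIV. ennreal (pi_hat N D) * h (D, n)) \<partial>count_space UNIV)"
    using pi_hat_nonneg pi_queue_pos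
    by (intro nn_integral_cong)
      (simp add: nn_integral_count_space_finite pi_tilde_def ennreal_mult sum_distrib_left less_imp_le mult_ac)
  finally show ?thesis .
qed

lemma pi_tilde_sum: "(pi_tilde N has_sum 1) UNIV"
proof (rule has_sum_nn_integral_count_space)
  have "(\<Sum>D\<in>UNIV. ennreal (pi_hat N D)) = 1"
    using pi_hat_nonneg by (simp add: sum_ennreal pi_hat_sum)
  hence "(\<integral>\<^sup>+x. 1 \<partial>dist_measure (pi_tilde N)) = (\<integral>\<^sup>+n. ennreal (pi_queue N n) \<partial>count_space UNIV)"
    unfolding nn_integral_pi_tilde by simp
  also have "\<dots> = 1"
    using nn_integral_count_space_has_sum[OF _ pi_queue_sum] pi_queue_pos by (simp add: less_imp_le)
  finally show "(\<integral>\<^sup>+x. ennreal (pi_tilde N x) \<partial>count_space UNIV) = ennreal 1"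
    unfolding nn_integral_dist_measure by simp
qed (simp_all add: pi_tilde_nonneg)

text \<open>
  The map adding a customer at node \<open>i\<close> is a bijection onto the states with \<open>n i > 0\<close>; on the other
  states the service rate is \<open>0\<close>. Along this map the weights satisfy \<open>pi_queue_inc\<close>. All
  invariance statements about moves of customers reduce to this identity.
\<close>
lemma shift_identity:
  "(\<integral>\<^sup>+x. ennreal (mu N i (snd x i)) * h x \<partial>dist_measure (pi_tilde N)) =
   (\<integral>\<^sup>+x. ennreal (eta N i) * h (fst x, inc i (snd x)) \<partial>dist_measure (pi_tilde N))"
proof -
  define up where "up = (\<lambda>x :: 'j state. (fst x, inc i (snd x)))"
  define g where "g x = ennreal (pi_tilde N x) * (ennreal (mu N i (snd x i)) * h x)" for x
  have inj: "inj up"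
  proof (rule injI)
    fix x y assume "up x = up y"
    hence "fst x = fst y" "dec i (inc i (snd x)) = dec i (inc i (snd y))" by (auto simp: up_def)
    thus "x = y" by (auto intro: prod_eqI)
  qed
  have zero: "g x = 0" if "x \<notin> range up" for x
  proof -
    have "snd x i = 0"
    proof (rule ccontr)
      assume "snd x i \<noteq> 0"
      hence "x = up (fst x, dec i (snd x))" by (simp add: up_def inc_dec)
      with that show False by blast
    qed
    thus ?thesis by (simp add: g_def mu_0)
  qed
  have shift: "g (up x) = ennreal (pi_tilde N x) * (ennreal (eta N i) * h (up x))" for x
  proof -
    obtain D n where x: "x = (D, n)" by (cases x)
    have "pi_tilde N (up x) * mu N i (snd (up x) i) = pi_hat N D * (pi_queue N (inc i n) * mu N i (Suc (n i)))"
      by (simp add: x up_def pi_tilde_def inc_def)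
    also have "\<dots> = pi_tilde N x * eta N i" by (simp add: pi_queue_inc x pi_tilde_def)
    finally have "ennreal (pi_tilde N (up x)) * ennreal (mu N i (snd (up x) i)) =
        ennreal (pi_tilde N x) * ennreal (eta N i)"
      using pi_tilde_nonneg mu_nonneg eta_pos[of i]
      by (simp add: ennreal_mult[symmetric] less_imp_le)
    thus ?thesis unfolding g_def by (simp only: mult.assoc[symmetric])
  qed
  have "(\<integral>\<^sup>+x. g x \<partial>count_space UNIV) = (\<integral>\<^sup>+x. g x \<partial>count_space (range up))"
    by (rule nn_integral_count_space_eq) (use zero in auto)
  also have "\<dots> = (\<integral>\<^sup>+x. g (up x) \<partial>count_space UNIV)"
    by (rule nn_integral_bij_count_space[symmetric]) (simp add: inj_on_imp_bij_betw inj)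
  finally show ?thesis
    unfolding nn_integral_dist_measure shift by (simp add: g_def up_def)
qed

lemma departure_after_arrival: "bd_move (Departure i) (bd_move (Arrival i) x) = x"
  by (cases x) simp

text \<open>
  Detailed balance between an arrival and the departure that undoes it.
\<close>
lemma departure_flow:
  "(\<integral>\<^sup>+x. ennreal (bd_rate N (Departure i) x) * h x \<partial>dist_measure (pi_tilde N)) =
   (\<integral>\<^sup>+x. ennreal (bd_rate N (Arrival i) x) * h (bd_move (Arrival i) x) \<partial>dist_measure (pi_tilde N))"
proof -
  define c where "c x = (if i \<in> fst x then 0 else route N (fst x) (Some i) None)" for x :: "'j state"
  have c: "0 \<le> c x" for x by (simp add: c_def route_nonneg)
  have dep: "bd_rate N (Departure i) x = mu N i (snd x i) * c x" for x
    by (cases x) (simp add: c_def)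
  have arr: "bd_rate N (Arrival i) x = eta N i * c x" for x
    by (cases x) (simp add: c_def entrance_departure_balance)
  have mv: "bd_move (Arrival i) x = (fst x, inc i (snd x))" for x :: "'j state" by (cases x) simp
  have cmv: "c (fst x, inc i (snd x)) = c x" for x by (simp add: c_def)
  show ?thesis
    using shift_identity[of i "\<lambda>x. ennreal (c x) * h x"] c mu_nonneg eta_pos[of i]
    unfolding dep arr mv by (simp add: ennreal_mult cmv mult.assoc less_imp_le)
qed

lemma switch_flow:
  "(\<integral>\<^sup>+x. (\<Sum>H\<in>UNIV. ennreal (bd_rate N (Switch H) x) * h (bd_move (Switch H) x)) \<partial>dist_measure (pi_tilde N)) =
   (\<integral>\<^sup>+x. (\<Sum>H\<in>UNIV. ennreal (bd_rate N (Switch H) x) * h x) \<partial>dist_measure (pi_tilde N))"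
proof -
  have rev: "ennreal (pi_hat N D) * (ennreal (qY N D H) * k) = ennreal (pi_hat N H) * (ennreal (qY N H D) * k)" for D H k
    using qY_reversible[of D H] pi_hat_nonneg qY_nonneg
    by (simp add: ennreal_mult[symmetric] mult.assoc[symmetric])
  have "(\<Sum>D\<in>UNIV. ennreal (pi_hat N D) * (\<Sum>H\<in>UNIV. ennreal (qY N D H) * h (H, n))) =
        (\<Sum>D\<in>UNIV. ennreal (pi_hat N D) * (\<Sum>H\<in>UNIV. ennreal (qY N D H) * h (D, n)))" for n
  proof -
    have "(\<Sum>D\<in>UNIV. ennreal (pi_hat N D) * (\<Sum>H\<in>UNIV. ennreal (qY N D H) * h (H, n))) =
        (\<Sum>D\<in>UNIV. \<Sum>H\<in>UNIV. ennreal (pi_hat N H) * (ennreal (qY N H D) * h (H, n)))"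
      unfolding sum_distrib_left by (intro sum.cong refl rev)
    also have "\<dots> = (\<Sum>H\<in>UNIV. \<Sum>D\<in>UNIV. ennreal (pi_hat N H) * (ennreal (qY N H D) * h (H, n)))"
      by (rule sum.swap)
    finally show ?thesis by (simp add: sum_distrib_left)
  qed
  thus ?thesis unfolding nn_integral_pi_tilde by simp
qed

lemma bd_balance:
  "(\<integral>\<^sup>+x. (\<Sum>m\<in>UNIV. ennreal (bd_rate N m x) * h (bd_move m x)) \<partial>dist_measure (pi_tilde N)) =
   (\<integral>\<^sup>+x. (\<Sum>m\<in>UNIV. ennreal (bd_rate N m x) * h x) \<partial>dist_measure (pi_tilde N))"
proof -
  let ?M = "dist_measure (pi_tilde N)" and ?r = "bd_rate N"
  have "(\<integral>\<^sup>+x. (\<Sum>m\<in>UNIV. ennreal (?r m x) * h (bd_move m x)) \<partial>?M) =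
      (\<Sum>i\<in>UNIV. \<integral>\<^sup>+x. ennreal (?r (Arrival i) x) * h (bd_move (Arrival i) x) \<partial>?M) +
      (\<Sum>i\<in>UNIV. \<integral>\<^sup>+x. ennreal (?r (Departure i) x) * h (bd_move (Departure i) x) \<partial>?M) +
      (\<integral>\<^sup>+x. (\<Sum>H\<in>UNIV. ennreal (?r (Switch H) x) * h (bd_move (Switch H) x)) \<partial>?M)"
    unfolding sum_move by (simp add: nn_integral_add nn_integral_sum)
  also have "\<dots> = (\<Sum>i\<in>UNIV. \<integral>\<^sup>+x. ennreal (?r (Departure i) x) * h x \<partial>?M) +
      (\<Sum>i\<in>UNIV. \<integral>\<^sup>+x. ennreal (?r (Arrival i) x) * h x \<partial>?M) +
      (\<integral>\<^sup>+x. (\<Sum>H\<in>UNIV. ennreal (?r (Switch H) x) * h x) \<partial>?M)"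
    by (simp only: departure_flow departure_after_arrival switch_flow)
  also have "\<dots> = (\<integral>\<^sup>+x. (\<Sum>m\<in>UNIV. ennreal (?r m x) * h x) \<partial>?M)"
    unfolding sum_move by (simp add: nn_integral_add nn_integral_sum add_ac)
  finally show ?thesis .
qed

lemma transfer_prob_nonneg: "0 \<le> transfer_prob N D j i"
  by (simp add: transfer_prob_def route_nonneg)

lemma transfer_prob_balance:
  "(\<Sum>j\<in>UNIV. eta N j * transfer_prob N D j i) = eta N i * (\<Sum>k\<in>UNIV. transfer_prob N D i k)"
proof (cases "i \<in> D")
  case False
  have "(\<Sum>j\<in>UNIV. eta N j * transfer_prob N D j i) = (\<Sum>j\<in>- D. eta N j * route N D (Some j) (Some i))"
    unfolding sum_compl using False by (intro sum.cong) (auto simp: transfer_prob_def)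
  also have "\<dots> = eta N i * (\<Sum>k\<in>- D. route N D (Some i) (Some k))"
    using overall[of D] False by (simp add: overall_balance_def)
  also have "(\<Sum>k\<in>- D. route N D (Some i) (Some k)) = (\<Sum>k\<in>UNIV. transfer_prob N D i k)"
    unfolding sum_compl using False by (intro sum.cong) (auto simp: transfer_prob_def)
  finally show ?thesis .
qed (simp add: transfer_prob_def)

text \<open>
  A transfer from \<open>j\<close> to \<open>i\<close> is a service at \<open>j\<close> followed by an arrival at \<open>i\<close>. Shifting by the
  customer in transit turns the inflow of transfers into a sum over the node \<open>j\<close> it comes from;
  overall balance exchanges this for the sum over the node \<open>k\<close> it could go to, and shifting back
  at \<open>i\<close> gives the outflow.
\<close>
lemma transfer_balance:
  "(\<integral>\<^sup>+x. (\<Sum>m\<in>UNIV. ennreal (transfer_rate N m x) * h (transfer_move m x)) \<partial>dist_measure (pi_tilde N)) =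
   (\<integral>\<^sup>+x. (\<Sum>m\<in>UNIV. ennreal (transfer_rate N m x) * h x) \<partial>dist_measure (pi_tilde N))"
proof -
  let ?M = "dist_measure (pi_tilde N)"
  let ?t = "\<lambda>x j i. transfer_prob N (fst x) j i"
  have rate: "ennreal (transfer_rate N (j, i) x) = ennreal (mu N j (snd x j)) * ennreal (?t x j i)" for j i x
    using mu_nonneg transfer_prob_nonneg by (cases x) (simp add: ennreal_mult)
  have mv: "transfer_move (j, i) x = (fst x, inc i (dec j (snd x)))" for j i and x :: "'j state"
    by (cases x) simp
  have "(\<integral>\<^sup>+x. (\<Sum>m\<in>UNIV. ennreal (transfer_rate N m x) * h (transfer_move m x)) \<partial>?M) =
     (\<Sum>j\<in>UNIV. \<Sum>i\<in>UNIV. \<integral>\<^sup>+x. ennreal (mu N j (snd x j)) *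
        (ennreal (?t x j i) * h (fst x, inc i (dec j (snd x)))) \<partial>?M)"
    unfolding sum_pairs rate mv by (simp add: nn_integral_sum mult.assoc)
  also have "\<dots> = (\<Sum>j\<in>UNIV. \<Sum>i\<in>UNIV. \<integral>\<^sup>+x. ennreal (eta N j) *
        (ennreal (?t x j i) * h (fst x, inc i (snd x))) \<partial>?M)"
    by (simp add: shift_identity)
  also have "\<dots> = (\<integral>\<^sup>+x. (\<Sum>i\<in>UNIV. ennreal (\<Sum>j\<in>UNIV. eta N j * ?t x j i) * h (fst x, inc i (snd x))) \<partial>?M)"
  proof -
    have "(\<Sum>i\<in>UNIV. ennreal (\<Sum>j\<in>UNIV. eta N j * ?t x j i) * h (fst x, inc i (snd x))) =
       (\<Sum>j\<in>UNIV. \<Sum>i\<in>UNIV. ennreal (eta N j) * (ennreal (?t x j i) * h (fst x, inc i (snd x))))" for x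
      using eta_pos transfer_prob_nonneg
      by (subst sum.swap) (simp add: sum_ennreal[symmetric] ennreal_mult sum_distrib_right mult.assoc less_imp_le del: sum_ennreal)
    thus ?thesis by (simp add: nn_integral_sum)
  qed
  also have "\<dots> = (\<integral>\<^sup>+x. (\<Sum>i\<in>UNIV. ennreal (eta N i) *
        (ennreal (\<Sum>k\<in>UNIV. ?t x i k) * h (fst x, inc i (snd x)))) \<partial>?M)"
    unfolding transfer_prob_balance using eta_pos transfer_prob_nonneg
    by (simp add: ennreal_mult sum_nonneg less_imp_le mult.assoc)
  also have "\<dots> = (\<Sum>i\<in>UNIV. \<integral>\<^sup>+x. ennreal (eta N i) *
        (ennreal (\<Sum>k\<in>UNIV. ?t x i k) * h (fst x, inc i (snd x))) \<partial>?M)"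
    by (simp add: nn_integral_sum)
  also have "\<dots> = (\<Sum>i\<in>UNIV. \<integral>\<^sup>+x. ennreal (mu N i (snd x i)) * (ennreal (\<Sum>k\<in>UNIV. ?t x i k) * h x) \<partial>?M)"
    by (simp add: shift_identity)
  also have "\<dots> = (\<integral>\<^sup>+x. (\<Sum>m\<in>UNIV. ennreal (transfer_rate N m x) * h x) \<partial>?M)"
    unfolding sum_pairs rate using transfer_prob_nonneg
    by (simp add: nn_integral_sum[symmetric] sum_ennreal[symmetric] sum_distrib_left sum_distrib_right mult.assoc del: sum_ennreal)
  finally show ?thesis .
qed

section \<open>Comparison with the birth-death network\<close>

lemma bd_rate_nonneg: "0 \<le> bd_rate N m x"
  using arr_pos mu_nonneg route_nonneg qY_nonneg
  by (cases m; cases x) (auto intro: mult_nonneg_nonneg less_imp_le)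

lemma transfer_rate_nonneg: "0 \<le> transfer_rate N m x"
  using mu_nonneg transfer_prob_nonneg by (cases m; cases x) simp

lemma mu_bounded: "\<exists>B\<ge>0. \<forall>j k. mu N j k \<le> B"
proof -
  obtain B where "\<forall>j k. mu N j k \<le> B"
    using jackson by (auto simp: jackson_network_def bdd_above_def)
  thus ?thesis using order_trans[OF mu_nonneg] by blast
qed

lemma bd_rate_bounded: "\<exists>K. \<forall>m x. bd_rate N m x \<le> K"
proof -
  obtain B where B: "0 \<le> B" "\<And>j k. mu N j k \<le> B" using mu_bounded by blast
  define S where "S = (\<Sum>D\<in>UNIV. \<Sum>H\<in>UNIV. qY N D H)"
  have S: "qY N D H \<le> S" for D H
  proof -
    have "qY N D H \<le> (\<Sum>H\<in>UNIV. qY N D H)" by (rule member_le_sum) (simp_all add: qY_nonneg)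
    also have "\<dots> \<le> S" unfolding S_def
      by (rule member_le_sum[where f = "\<lambda>D. \<Sum>H\<in>UNIV. qY N D H"]) (simp_all add: qY_nonneg sum_nonneg)
    finally show ?thesis .
  qed
  hence S0: "0 \<le> S" using qY_nonneg order_trans by blast
  have "bd_rate N m x \<le> arr N + B + S" for m x
  proof (cases m; cases x)
    fix i D n assume m: "m = Arrival i" "x = (D, n)"
    have "bd_rate N m x \<le> arr N"
      using arr_pos route_le_1[of None D "Some i"] by (auto simp: m)
    thus ?thesis using S0 B(1) by linarith
  next
    fix i D n assume m: "m = Departure i" "x = (D, n)"
    have "i \<notin> D \<Longrightarrow> mu N i (n i) * route N D (Some i) None \<le> B * 1"
      using B mu_nonneg route_le_1[of "Some i" D None] route_nonneg[of "Some i" D None]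
      by (intro mult_mono) auto
    thus ?thesis using m S0 B(1) arr_pos by auto
  next
    fix H D n assume m: "m = Switch H" "x = (D, n)"
    thus ?thesis using S[of D H] B(1) arr_pos by auto
  qed
  thus ?thesis by blast
qed

lemma transfer_rate_bounded: "\<exists>K. \<forall>m x. transfer_rate N m x \<le> K"
proof -
  obtain B where B: "0 \<le> B" "\<And>j k. mu N j k \<le> B" using mu_bounded by blast
  have "transfer_prob N D j i \<le> 1" for D j i
    by (simp add: transfer_prob_def route_le_1)
  hence "mu N j k * transfer_prob N D j i \<le> B * 1" for D j i k
    using B mu_nonneg transfer_prob_nonneg by (intro mult_mono) auto
  hence "transfer_rate N m x \<le> B" for m x by (cases m; cases x) simp
  thus ?thesis by blast
qed

sublocale bd: jump_generator "bd_rate N" bd_move "pi_tilde N"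
  by standard
    (rule bd_rate_nonneg bd_rate_bounded pi_tilde_nonneg pi_tilde_sum bd_balance)+

sublocale transfer: jump_generator "transfer_rate N" transfer_move "pi_tilde N"
  by standard
    (rule transfer_rate_nonneg transfer_rate_bounded pi_tilde_nonneg pi_tilde_sum transfer_balance)+

lemma QZ_bd: "QZ (bd_network N) = bd.gen"
  by (intro ext) (simp add: QZ_bd_network[OF mu_0] bd.gen_def)

lemma QZ_split: "QZ N f x = bd.gen f x + transfer.gen f x"
  by (simp add: QZ_decompose bd.gen_def transfer.gen_def)

text \<open>
  Both infima range over the same functions, and for each of them the two Dirichlet forms differ by
  the nonnegative form of the transfers.
\<close>
proposition gap_bd_le: "Gap (QZ (bd_network N)) (pi_tilde N) \<le> Gap (QZ N) (pi_tilde N)"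
proof -
  let ?p = "pi_tilde N"
  define F where "F = {f. f \<in> L2 ?p \<and> (\<integral>x. f x \<partial>dist_measure ?p) = 0 \<and> inner_prod ?p f f = 1}"
  have gap: "Gap Q ?p = (INF f\<in>F. inner_prod ?p f (\<lambda>x. - Q f x))" for Q :: "'j state generator"
    unfolding Gap_def F_def by (intro arg_cong[where f = Inf]) auto
  have le: "inner_prod ?p f (\<lambda>x. - QZ (bd_network N) f x) \<le> inner_prod ?p f (\<lambda>x. - QZ N f x)"
    if "f \<in> F" for f
  proof -
    have f: "f \<in> L2 ?p" using that by (simp add: F_def)
    have "inner_prod ?p f (\<lambda>x. - QZ N f x) =
        inner_prod ?p f (\<lambda>x. - bd.gen f x) + inner_prod ?p f (\<lambda>x. - transfer.gen f x)"
      using Bochner_Integration.integral_add[OF bd.dirichlet_form_nonneg(1)[OF f] transfer.dirichlet_form_nonneg(1)[OF f]]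
      unfolding inner_prod_def QZ_split by (simp add: algebra_simps)
    thus ?thesis using transfer.dirichlet_form_nonneg(2)[OF f] unfolding QZ_bd by simp
  qed
  show ?thesis
  \<comment> \<open>For an empty \<open>F\<close> both gaps are the same infimum of the empty set.\<close>
  proof (cases "F = {}")
    case False
    show ?thesis unfolding gap
    proof (rule cINF_mono[OF False])
      show "bdd_below ((\<lambda>f. inner_prod ?p f (\<lambda>x. - QZ (bd_network N) f x)) ` F)"
        using bd.dirichlet_form_nonneg(2) by (intro bdd_belowI[of _ 0]) (auto simp: F_def QZ_bd)
    qed (use le in blast)
  qed (simp add: gap)
qed

text \<open>
  Every state of the support is joined to the empty network with all nodes up: repair all nodes at
  once, then undo arrivals. From a null state the full repair has rate \<open>B(D) / B({}) = B(D)\<close>,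
  which takes finitely many positive values.
\<close>
proposition ergodic_bd: "ergodic (QZ (bd_network N))"
  unfolding QZ_bd
proof (rule bd.ergodic_gen)
  have repair: "equivclp bd.edge (D, n) ({}, n)" if "0 < brk N D" for D n
  proof (cases "D = {}")
    case False
    hence "0 < bd_rate N (Switch {}) (D, n)" using rep_pos[of D] by (auto simp: qY_def rep_empty)
    hence "bd.edge (D, n) ({}, n)"
      unfolding bd.edge_def using that pi_tilde_pos_iff[of D n] by (intro conjI exI[of _ "Switch {}"]) auto
    thus ?thesis by (rule r_into_equivclp)
  qed simp
  have fill: "equivclp bd.edge ({}, \<lambda>_. 0) ({}, n)" for n
  proof (induction "\<Sum>i\<in>UNIV. n i" arbitrary: n)
    case 0
    hence "n = (\<lambda>_. 0)" by (auto simp: fun_eq_iff)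
    thus ?case by simp
  next
    case (Suc k)
    then obtain i where i: "0 < n i" by (metis gr0I sum.neutral zero_less_Suc less_irrefl)
    have "(\<Sum>j\<in>UNIV. n j) = Suc (\<Sum>j\<in>UNIV. dec i n j)"
      using i by (simp add: sum.remove[of UNIV i] dec_def)
    hence "equivclp bd.edge ({}, \<lambda>_. 0) ({}, dec i n)" using Suc by simp
    moreover have "bd.edge ({}, dec i n) ({}, n)"
      unfolding bd.edge_def
      using pi_tilde_pos_iff[of "{}" "dec i n"] arr_pos entrance_departure_pos[of "{}" i] inc_dec[of n i, OF i]
      by (intro conjI exI[of _ "Arrival i"]) (auto simp: brk_empty pi_hat_pos_iff)
    ultimately show ?case by (meson equivclp_into_equivclp)
  qed
  show "equivclp bd.edge x y" if "0 < pi_tilde N x" "0 < pi_tilde N y" for x y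
  proof -
    have "equivclp bd.edge z ({}, \<lambda>_. 0)" if "0 < pi_tilde N z" for z
    proof -
      obtain D n where z: "z = (D, n)" by (cases z)
      have "equivclp bd.edge z ({}, n)" using that repair unfolding z pi_tilde_pos_iff by blast
      thus ?thesis using equivclp_sym[OF fill[of n]] by (rule equivclp_trans)
    qed
    from this[OF that(1)] this[OF that(2), THEN equivclp_sym] show ?thesis by (rule equivclp_trans)
  qed
  show "0 < Min (range (rep N))" using rep_pos by simp
  show "\<exists>m. Min (range (rep N)) \<le> bd_rate N m x \<and> 0 < pi_tilde N (bd_move m x)"
    if "pi_tilde N x = 0" for x
  proof -
    obtain D n where x: "x = (D, n)" by (cases x)
    have "D \<noteq> {}" using that pi_tilde_pos_iff[of D n] brk_empty by (auto simp: x)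
    hence "bd_rate N (Switch {}) x = rep N D" by (auto simp: x qY_def rep_empty)
    moreover have "0 < pi_tilde N (bd_move (Switch {}) x)" by (simp add: x pi_tilde_pos_iff brk_empty)
    ultimately show ?thesis by (intro exI[of _ "Switch {}"]) simp
  qed
qed

lemma bd_network_rerouting: "rerouting (bd_network N)"
  unfolding rerouting_def
proof (intro allI conjI)
  fix D
  show "stochastic_on (up_nodes0 D) (route (bd_network N) D)"
    unfolding stochastic_on_def
  proof (intro ballI conjI)
    fix u assume u: "u \<in> up_nodes0 D"
    show "0 \<le> route (bd_network N) D u v" if "v \<in> up_nodes0 D" for v
      using u that route_nonneg[OF u that] route_le_1[of u D None]
      by (cases u; cases v) auto
    have "(\<Sum>v\<in>up_nodes0 D. route (bd_network N) D u v) =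
        route (bd_network N) D u None + (\<Sum>i\<in>- D. route (bd_network N) D u (Some i))"
      by (simp add: up_nodes0_def sum.reindex)
    also have "\<dots> = 1"
      using u route_row[OF u] by (cases u) auto
    finally show "(\<Sum>v\<in>up_nodes0 D. route (bd_network N) D u v) = 1" .
  qed
  show "traffic (bd_network N) D"
    unfolding traffic_def
  proof
    fix j assume j: "j \<in> - D"
    have "(\<Sum>i\<in>- D. eta N i * route (bd_network N) D (Some i) (Some j)) =
        (\<Sum>i\<in>- D. if i = j then eta N j * (1 - route N D (Some j) None) else 0)"
      by (intro sum.cong) auto
    also have "\<dots> = eta N j - eta N j * route N D (Some j) None"
      using j by (simp add: right_diff_distrib)
    finally show "eta (bd_network N) j = arr (bd_network N) * route (bd_network N) D None (Some j) +
        (\<Sum>i\<in>- D. eta (bd_network N) i * route (bd_network N) D (Some i) (Some j))"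
      using entrance_departure_balance[of j D] j by simp
  qed
qed

lemma bd_network_irreducible: "irreducible_on UNIV (route (bd_network N) {})"
  unfolding irreducible_on_def
proof (intro ballI)
  fix u v
  let ?E = "{(a, b). a \<in> UNIV \<and> b \<in> UNIV \<and> 0 < route (bd_network N) {} a b}"
  have pos: "0 < route N {} None (Some i)" "0 < route N {} (Some i) None" for i
    using entrance_departure_pos[of "{}" i] by (simp_all add: pi_hat_pos_iff brk_empty)
  have "(u, None) \<in> ?E\<^sup>*" by (cases u) (auto simp: pos)
  moreover have "(None, v) \<in> ?E\<^sup>*" by (cases v) (auto simp: pos)
  ultimately show "(u, v) \<in> ?E\<^sup>*" by (rule rtrancl_trans)
qed

lemma bd_network_jackson: "jackson_network (bd_network N)"
proof -
  have "service_weight (bd_network N) = service_weight N"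
    by (simp add: fun_eq_iff service_weight_def)
  moreover have "stochastic_on UNIV (route (bd_network N) {})" "traffic (bd_network N) {}"
    using bd_network_rerouting by (auto simp: rerouting_def up_nodes0_def UNIV_option_conv dest: spec[of _ "{}"])
  ultimately show ?thesis
    using jackson bd_network_irreducible by (simp add: jackson_network_def)
qed

lemma rate_gen:
  assumes "y \<noteq> x" shows "rate bd.gen x y = (\<Sum>m\<in>UNIV. if bd_move m x = y then bd_rate N m x else 0)"
  unfolding rate_def bd.gen_def using assms assms[symmetric]
  by (intro sum.cong refl) (auto simp: indicator_def)

text \<open>
  The rates can be read off because different moves out of a state have different targets. This
  fails for departures from empty queues, where \<open>dec\<close> truncates to the state itself; hence the
  restriction to \<open>n i > 0\<close>.
\<close>
lemma bd_network_birth_death: "cond_indep_birth_death N (QZ (bd_network N))"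
proof -
  have at_node: "inc i n i = Suc (n i)" "dec i n i = n i - 1" "dec k n i \<le> n i" for i k :: 'j and n
    by (simp_all add: inc_def dec_def)
  have up: "n \<noteq> inc i n" "dec k n \<noteq> inc i n" "inc i n \<noteq> dec k n" for i k :: 'j and n
    using at_node(1)[of i n] at_node(3)[of k n i] by (metis Suc_n_not_le_n order_refl)+
  have up_inj: "inc k n = inc i n \<longleftrightarrow> k = i" for i k :: 'j and n
    using at_node(1)[of i n] by (auto simp: inc_def fun_upd_def dest: fun_cong[of _ _ i] split: if_splits)
  have down: "n \<noteq> dec i n" if "0 < n i" for i :: 'j and n
    using at_node(2)[of i n] that by (metis diff_less less_irrefl zero_less_one)
  have down_inj: "dec k n = dec i n \<longleftrightarrow> k = i" if "0 < n i" for i k :: 'j and n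
  proof
    assume "dec k n = dec i n"
    hence "dec k n i \<noteq> n i" using at_node(2)[of i n] that by simp
    thus "k = i" by (auto simp: dec_def split: if_splits)
  qed simp
  show ?thesis
    unfolding cond_indep_birth_death_def QZ_bd
  proof (intro allI conjI ballI impI)
    fix D :: "'j set" and n :: "'j \<Rightarrow> nat"
    fix i assume "i \<in> - D"
    thus "rate bd.gen (D, n) (D, inc i n) = arr N * route N D None (Some i)"
      by (simp add: rate_gen sum_move up_inj up up(1)[symmetric])
  next
    fix D :: "'j set" and n :: "'j \<Rightarrow> nat"
    fix i assume "i \<in> - D" "0 < n i"
    thus "rate bd.gen (D, n) (D, dec i n) = mu N i (n i) * route N D (Some i) None"
      by (simp add: rate_gen sum_move down_inj up down down[symmetric])
  next
    fix D H :: "'j set" and n :: "'j \<Rightarrow> nat"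
    assume "H \<noteq> D"
    thus "rate bd.gen (D, n) (H, n) = qY N D H"
      by (simp add: rate_gen sum_move)
  next
    fix D :: "'j set" and n :: "'j \<Rightarrow> nat" and y
    assume y: "y \<noteq> (D, n)" and none: "\<forall>i\<in>- D. y \<noteq> (D, inc i n) \<and> y \<noteq> (D, dec i n)" "\<forall>H. y \<noteq> (H, n)"
    have "(if bd_move m (D, n) = y then bd_rate N m (D, n) else 0) = 0" for m
      using none by (cases m) auto
    thus "rate bd.gen (D, n) y = 0"
      unfolding rate_gen[OF y] by (intro sum.neutral ballI)
  qed
qed

end

theorem proposition4p5:
  fixes N :: "'j::finite network"
  assumes "jackson_network N" and "breakdown_repair N" and "rerouting N"
    and "ergodic (QZ N)"
    and "\<And>D i. pi_hat N D > 0 \<Longrightarrow> i \<in> - D \<Longrightarrow>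
           route N D None (Some i) > 0 \<and> route N D (Some i) None > 0"
    and "\<And>D. overall_balance N D"
  shows "\<exists>N' :: 'j network.
           jackson_network N' \<and> breakdown_repair N' \<and> rerouting N' \<and>
           ergodic (QZ N') \<and>
           stationary_distribution (QZ N') (pi_tilde N) \<and>
           Gap (QZ N') (pi_tilde N) \<le> Gap (QZ N) (pi_tilde N) \<and>
           brk N' = brk N \<and> rep N' = rep N \<and>
           cond_indep_birth_death N (QZ N')"
proof -
  interpret balanced_network N
    by unfold_locales (use assms ergodic_imp_rep_pos[OF assms(2,4)] in auto)
  have "breakdown_repair (bd_network N)"
    using assms(2) by (simp add: breakdown_repair_def)
  moreover have "stationary_distribution (QZ (bd_network N)) (pi_tilde N)"
    unfolding QZ_bd by (rule bd.stationary)
  ultimately show ?thesis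
    using bd_network_jackson bd_network_rerouting ergodic_bd gap_bd_le bd_network_birth_death
    by (intro exI[of _ "bd_network N"]) simp
qed

end
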